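(* Let $(E_6)^{\lambda\gamma}=\{\alpha\in E_6\mid \lambda(\gamma\alpha\gamma)=\alpha\}$ and $(E_6)^{\gamma}=\{\alpha\in E_6\mid \gamma\alpha\gamma=\alpha\}$. Then $$(E_6)^{\lambda\gamma}\cap (E_6)^{\gamma}\;\cong\;(Sp(1)\times Sp(3))/\mathbf{Z}_2,\qquad \mathbf{Z}_2=\{(1,E),(-1,-E)\}.$$
   Context: Let $\mathbf{H}$ be the quaternions and $\mathfrak{C}=\mathbf{H}\oplus\mathbf{H}e_4$ the division Cayley algebra with product $(m+ae_4)(n+be_4)=(mn-\overline{b}a)+(a\overline{n}+bm)e_4$. Let $\mathfrak{J}=\{X\in M(3,\mathfrak{C})\mid X^*=X\}$ and let $\mathfrak{J}^C=\mathfrak{J}\oplus i\mathfrak{J}$ be its complexification ($C=\mathbf{R}\oplus\mathbf{R}i$), with $X\circ Y=\frac12(XY+YX)$, $(X,Y)=\mathrm{tr}(X\circ Y)$, $X\times Y=\frac12\big(2X\circ Y-\mathrm{tr}(X)Y-\mathrm{tr}(Y)X+(\mathrm{tr}(X)\mathrm{tr}(Y)-(X,Y))E\big)$, $\det X=\frac13(X,X\times X)$, complex conjugation $\tau(X+iY)=X-iY$ ($X,Y\in\mathfrak{J}$), and $\langle X,Y\rangle=(\tau X,Y)$. Then $E_6=\{\alpha\in\mathrm{Iso}_C(\mathfrak{J}^C)\mid \det\alpha X=\det X,\ \langle\alpha X,\alpha Y\rangle=\langle X,Y\rangle\}$. $\lambda$ is the involutive automorphism of $E_6$ given by $\lambda(\alpha)={}^t\alpha^{-1}=\tau\alpha\tau$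 (transpose with respect to $(X,Y)$). The involutive element $\gamma\in E_6$ is the $C$-linear map acting entrywise by $\gamma(x+ye_4)=x-ye_4$ ($x,y\in\mathbf{H}$). $Sp(n)=\{A\in M(n,\mathbf{H})\mid AA^*=E\}$. *)

theory Defs
  imports "HOL-Analysis.Analysis" "HOL-Algebra.Coset" "HOL-Algebra.Bij"
begin

section \<open>Quaternions with coefficients in a commutative ring\<close>

text \<open>The quaternions are \<open>real quat\<close>; their complexification is \<open>complex quat\<close>. In the
  latter the complex unit is a central scalar, distinct from the quaternion units.\<close>

datatype 'a quat = Quat (qre: 'a) (qi: 'a) (qj: 'a) (qk: 'a)

instantiation quat :: (ab_group_add) ab_group_add
begin
definition "0 = Quat 0 0 0 0"
definition "x + y = Quat (qre x + qre y) (qi x + qi y) (qj x + qj y) (qk x + qk y)"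
definition "x - y = Quat (qre x - qre y) (qi x - qi y) (qj x - qj y) (qk x - qk y)"
definition "- x = Quat (- qre x) (- qi x) (- qj x) (- qk x)"
instance
  by standard
    (auto simp: zero_quat_def plus_quat_def minus_quat_def uminus_quat_def algebra_simps)
end

instantiation quat :: (comm_ring_1) ring_1
begin
definition "1 = Quat 1 0 0 0"
definition "x * y = Quat
  (qre x * qre y - qi x * qi y - qj x * qj y - qk x * qk y)
  (qre x * qi y + qi x * qre y + qj x * qk y - qk x * qj y)
  (qre x * qj y - qi x * qk y + qj x * qre y + qk x * qi y)
  (qre x * qk y + qi x * qj y - qj x * qi y + qk x * qre y)"
instance
  by standard
    (auto simp: one_quat_def times_quat_def zero_quat_def plus_quat_def algebra_simps)
end

text \<open>The topology of the fourfold product.\<close>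

instantiation quat :: (topological_space) topological_space
begin
definition "open S \<longleftrightarrow> open ((\<lambda>(a, b, c, d). Quat a b c d) -` S)"
instance
  by standard (auto simp: open_quat_def vimage_Int vimage_Union intro: open_Int open_UN)
end

definition qcnj :: "'a::ab_group_add quat \<Rightarrow> 'a quat" where
  "qcnj x = Quat (qre x) (- qi x) (- qj x) (- qk x)"

section \<open>Cayley numbers with coefficients in a commutative ring\<close>

text \<open>\<open>Oct m a\<close> stands for \<open>m + a e\<^sub>4\<close>. The product is not associative, so there is no
  instance of a semiring class and matrix products of Cayley matrices are defined separately.\<close>

datatype 'a oct = Oct (hpart: "'a quat") (epart: "'a quat")

instantiation oct :: (ab_group_add) ab_group_add
begin
definition "0 = Oct 0 0"
definition "x + y = Oct (hpart x + hpart y) (epart x + epart y)"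
definition "x - y = Oct (hpart x - hpart y) (epart x - epart y)"
definition "- x = Oct (- hpart x) (- epart x)"
instance
  by standard
    (auto simp: zero_oct_def plus_oct_def minus_oct_def uminus_oct_def algebra_simps)
end

instantiation oct :: (comm_ring_1) "{one, times}"
begin
definition "1 = Oct 1 0"
definition "x * y = Oct
  (hpart x * hpart y - qcnj (epart y) * epart x)
  (epart x * qcnj (hpart y) + epart y * hpart x)"
instance ..
end

instantiation oct :: (topological_space) topological_space
begin
definition "open S \<longleftrightarrow> open ((\<lambda>(m, a). Oct m a) -` S)"
instance
  by standard (auto simp: open_oct_def vimage_Int vimage_Union intro: open_Int open_UN)
end

definition ocnj :: "'a::ab_group_add oct \<Rightarrow> 'a oct" where
  "ocnj x = Oct (qcnj (hpart x)) (- epart x)"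

section \<open>The Jordan algebra and its complexification\<close>

definition oadj :: "'a::ab_group_add oct^'n^'m \<Rightarrow> 'a oct^'m^'n" where
  "oadj X = (\<chi> i j. ocnj (X $ j $ i))"

definition omult :: "'a::comm_ring_1 oct^'n^'m \<Rightarrow> 'a oct^'k^'n \<Rightarrow> 'a oct^'k^'m" where
  "omult X Y = (\<chi> i j. \<Sum>k\<in>UNIV. X $ i $ k * Y $ k $ j)"

definition cscale :: "'a::comm_ring_1 \<Rightarrow> 'a oct^'n^'m \<Rightarrow> 'a oct^'n^'m" where
  "cscale c = map_matrix (map_oct ((*) c))"

definition J :: "(real oct^3^3) set" where
  "J = {X. oadj X = X}"

definition complexify :: "real oct^'n^'m \<Rightarrow> complex oct^'n^'m" where
  "complexify = map_matrix (map_oct complex_of_real)"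

definition JC :: "(complex oct^3^3) set" where
  "JC = {complexify X + cscale \<i> (complexify Y) | X Y. X \<in> J \<and> Y \<in> J}"

text \<open>The complex conjugation of \<open>JC\<close> with respect to \<open>J\<close>; it does not conjugate the
  Cayley units.\<close>

definition tau :: "complex oct^3^3 \<Rightarrow> complex oct^3^3" where
  "tau = map_matrix (map_oct cnj)"

definition jprod :: "complex oct^3^3 \<Rightarrow> complex oct^3^3 \<Rightarrow> complex oct^3^3" where
  "jprod X Y = cscale (1 / 2) (omult X Y + omult Y X)"

text \<open>On \<open>JC\<close> the diagonal entries are scalars, identified here with complex numbers.\<close>

definition jtr :: "complex oct^3^3 \<Rightarrow> complex" where
  "jtr X = (\<Sum>i\<in>UNIV. qre (hpart (X $ i $ i)))"

definition jinner :: "complex oct^3^3 \<Rightarrow> complex oct^3^3 \<Rightarrow> complex" where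
  "jinner X Y = jtr (jprod X Y)"

definition jcross :: "complex oct^3^3 \<Rightarrow> complex oct^3^3 \<Rightarrow> complex oct^3^3" where
  "jcross X Y = cscale (1 / 2)
     (cscale 2 (jprod X Y) - cscale (jtr X) Y - cscale (jtr Y) X
      + cscale (jtr X * jtr Y - jinner X Y) (mat 1))"

definition jdet :: "complex oct^3^3 \<Rightarrow> complex" where
  "jdet X = (1 / 3) * jinner X (jcross X X)"

definition jherm :: "complex oct^3^3 \<Rightarrow> complex oct^3^3 \<Rightarrow> complex" where
  "jherm X Y = jinner (tau X) Y"

section \<open>The group \<open>E\<^sub>6\<close> and its subgroups\<close>

text \<open>Transformations of \<open>JC\<close> are extensional functions, as in \<^const>\<open>BijGroup\<close>.\<close>

definition Iso_C :: "(complex oct^3^3 \<Rightarrow> complex oct^3^3) set" where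
  "Iso_C = {\<alpha> \<in> Bij JC.
     (\<forall>X\<in>JC. \<forall>Y\<in>JC. \<alpha> (X + Y) = \<alpha> X + \<alpha> Y) \<and>
     (\<forall>c. \<forall>X\<in>JC. \<alpha> (cscale c X) = cscale c (\<alpha> X))}"

definition E6 :: "(complex oct^3^3 \<Rightarrow> complex oct^3^3) set" where
  "E6 = {\<alpha> \<in> Iso_C. (\<forall>X\<in>JC. jdet (\<alpha> X) = jdet X) \<and>
     (\<forall>X\<in>JC. \<forall>Y\<in>JC. jherm (\<alpha> X) (\<alpha> Y) = jherm X Y)}"

text \<open>By \<open>lambda_inverse_transpose\<close> below, this is the inverse of the transpose of \<open>\<alpha>\<close>
  with respect to \<^const>\<open>jinner\<close>.\<close>

definition lambda :: "(complex oct^3^3 \<Rightarrow> complex oct^3^3) \<Rightarrow> complex oct^3^3 \<Rightarrow> complex oct^3^3"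
  where "lambda \<alpha> = (\<lambda>X\<in>JC. tau (\<alpha> (tau X)))"

definition gamma :: "complex oct^3^3 \<Rightarrow> complex oct^3^3" where
  "gamma = (\<lambda>X\<in>JC. map_matrix (\<lambda>z. Oct (hpart z) (- epart z)) X)"

definition E6_lambda_gamma :: "(complex oct^3^3 \<Rightarrow> complex oct^3^3) set" where
  "E6_lambda_gamma = {\<alpha> \<in> E6. lambda (compose JC gamma (compose JC \<alpha> gamma)) = \<alpha>}"

definition E6_gamma :: "(complex oct^3^3 \<Rightarrow> complex oct^3^3) set" where
  "E6_gamma = {\<alpha> \<in> E6. compose JC gamma (compose JC \<alpha> gamma) = \<alpha>}"

text \<open>Pointwise convergence on \<open>JC\<close>; on linear maps this is the usual topology, as \<open>JC\<close>
  has finite dimension.\<close>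

definition JC_map_topology :: "(complex oct^3^3 \<Rightarrow> complex oct^3^3) topology" where
  "JC_map_topology = product_topology (\<lambda>_. euclidean) JC"

section \<open>Symplectic groups\<close>

definition qadj :: "'a::ab_group_add quat^'n^'m \<Rightarrow> 'a quat^'m^'n" where
  "qadj A = (\<chi> i j. qcnj (A $ j $ i))"

definition Sp :: "(real quat^'n^'n) monoid" where
  "Sp = \<lparr>carrier = {A. A ** qadj A = mat 1}, mult = (**), one = mat 1\<rparr>"

definition Z2 :: "((real quat^1^1) \<times> (real quat^3^3)) set" where
  "Z2 = {(mat 1, mat 1), (- mat 1, - mat 1)}"

section \<open>Isomorphism of topological groups\<close>

definition quotient_topology :: "('a, 'b) monoid_scheme \<Rightarrow> 'a topology \<Rightarrow> 'a set \<Rightarrow> 'a set topology"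
  where "quotient_topology G T H = topology (\<lambda>U. U \<subseteq> carrier (G Mod H) \<and>
     openin T {x \<in> carrier G. H #>\<^bsub>G\<^esub> x \<in> U})"

definition topological_group_isomorphic ::
    "('a, 'c) monoid_scheme \<Rightarrow> 'a topology \<Rightarrow> ('b, 'd) monoid_scheme \<Rightarrow> 'b topology \<Rightarrow> bool"
  where "topological_group_isomorphic G T H T' \<longleftrightarrow>
     (\<exists>f. f \<in> iso G H \<and> homeomorphic_map T T' f)"

section \<open>Basic consistency facts\<close>

lemma openin_quotient_topology:
  "openin (quotient_topology G T H) U \<longleftrightarrow>
     U \<subseteq> carrier (G Mod H) \<and> openin T {x \<in> carrier G. H #>\<^bsub>G\<^esub> x \<in> U}"
proof -
  have "istopology (\<lambda>U. U \<subseteq> carrier (G Mod H) \<and> openin T {x \<in> carrier G. H #>\<^bsub>G\<^esub> x \<in> U})"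
    unfolding istopology_def
  proof (intro conjI allI impI; (elim conjE)?)
    fix A B
    assume "openin T {x \<in> carrier G. H #>\<^bsub>G\<^esub> x \<in> A}" "openin T {x \<in> carrier G. H #>\<^bsub>G\<^esub> x \<in> B}"
    then have "openin T ({x \<in> carrier G. H #>\<^bsub>G\<^esub> x \<in> A} \<inter> {x \<in> carrier G. H #>\<^bsub>G\<^esub> x \<in> B})"
      by (rule openin_Int)
    also have "\<dots> = {x \<in> carrier G. H #>\<^bsub>G\<^esub> x \<in> A \<inter> B}" by auto
    finally show "openin T {x \<in> carrier G. H #>\<^bsub>G\<^esub> x \<in> A \<inter> B}" .
  next
    fix \<K>
    assume *: "\<forall>K\<in>\<K>. K \<subseteq> carrier (G Mod H) \<and> openin T {x \<in> carrier G. H #>\<^bsub>G\<^esub> x \<in> K}"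
    then have "openin T (\<Union>K\<in>\<K>. {x \<in> carrier G. H #>\<^bsub>G\<^esub> x \<in> K})" by auto
    also have "(\<Union>K\<in>\<K>. {x \<in> carrier G. H #>\<^bsub>G\<^esub> x \<in> K}) = {x \<in> carrier G. H #>\<^bsub>G\<^esub> x \<in> \<Union>\<K>}"
      by auto
    finally show "openin T {x \<in> carrier G. H #>\<^bsub>G\<^esub> x \<in> \<Union>\<K>}" .
  qed auto
  then show ?thesis
    by (simp add: quotient_topology_def)
qed

lemma quotient_map_quotient_topology:
  assumes "topspace T = carrier G"
  shows "quotient_map T (quotient_topology G T H) (\<lambda>x. H #>\<^bsub>G\<^esub> x)"
proof -
  have "{x \<in> carrier G. H #>\<^bsub>G\<^esub> x \<in> carrier (G Mod H)} = topspace T"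
    by (auto simp: assms carrier_FactGroup)
  then have "openin (quotient_topology G T H) (carrier (G Mod H))"
    by (simp add: openin_quotient_topology)
  then have "topspace (quotient_topology G T H) = carrier (G Mod H)"
    by (metis openin_quotient_topology openin_subset openin_topspace subset_antisym)
  then show ?thesis
    by (auto simp: quotient_map_def assms carrier_FactGroup openin_quotient_topology)
qed

lemma quat_eq_iff: "x = y \<longleftrightarrow> qre x = qre y \<and> qi x = qi y \<and> qj x = qj y \<and> qk x = qk y"
  by (auto intro: quat.expand)

lemma oct_eq_iff: "x = y \<longleftrightarrow> hpart x = hpart y \<and> epart x = epart y"
  by (auto intro: oct.expand)

lemmas oct_arith = quat_eq_iff oct_eq_iff zero_quat_def plus_quat_def minus_quat_def uminus_quat_def one_quat_def
  times_quat_def zero_oct_def plus_oct_def minus_oct_def uminus_oct_def one_oct_def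
  times_oct_def qcnj_def ocnj_def

lemma mem_JC_iff: "X \<in> JC \<longleftrightarrow> oadj X = X"
proof
  assume "X \<in> JC"
  then obtain A B where "A \<in> J" "B \<in> J" and X: "X = complexify A + cscale \<i> (complexify B)"
    by (auto simp: JC_def)
  then show "oadj X = X"
    unfolding X J_def oadj_def complexify_def cscale_def
    by (simp add: vec_eq_iff oct_arith quat.map_sel oct.map_sel complex_eq_iff)
next
  assume X: "oadj X = X"
  define A where "A = map_matrix (map_oct Re) X"
  define B where "B = map_matrix (map_oct Im) X"
  have "A \<in> J" "B \<in> J"
    using X unfolding J_def oadj_def A_def B_def
    by (simp_all add: vec_eq_iff oct_arith quat.map_sel oct.map_sel complex_eq_iff)
  moreover have "X = complexify A + cscale \<i> (complexify B)"
    unfolding A_def B_def complexify_def cscale_def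
    by (simp add: vec_eq_iff oct_arith quat.map_sel oct.map_sel complex_eq_iff)
  ultimately show "X \<in> JC"
    unfolding JC_def by blast
qed

lemma tau_complexify:
  "tau (complexify X + cscale \<i> (complexify Y)) = complexify X - cscale \<i> (complexify Y)"
  unfolding tau_def complexify_def cscale_def
  by (auto simp: vec_eq_iff oct_arith quat.map_sel oct.map_sel)

lemma tau_tau [simp]: "tau (tau X) = X"
  by (auto simp: tau_def vec_eq_iff oct_arith quat.map_sel oct.map_sel)

lemma tau_in_JC: "X \<in> JC \<Longrightarrow> tau X \<in> JC"
  unfolding mem_JC_iff
  by (simp add: tau_def oadj_def vec_eq_iff oct_arith quat.map_sel oct.map_sel
      flip: complex_cnj_minus)

lemma lambda_inverse_transpose:
  assumes "\<alpha> \<in> E6" "X \<in> JC" "Y \<in> JC"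
  shows "jinner (lambda \<alpha> X) (\<alpha> Y) = jinner X Y"
  using assms tau_in_JC[of X] by (auto simp: E6_def jherm_def lambda_def dest!: bspec[of JC _ "tau X"])

lemma complexify_mult: "complexify (omult X Y) = omult (complexify X) (complexify Y)"
proof -
  have mult: "map_oct complex_of_real (x * y)
      = map_oct complex_of_real x * map_oct complex_of_real y" for x y
    by (auto simp: oct_arith quat.map_sel oct.map_sel)
  have add: "map_oct complex_of_real (x + y)
      = map_oct complex_of_real x + map_oct complex_of_real y" for x y
    by (auto simp: oct_arith quat.map_sel oct.map_sel)
  have zero: "map_oct complex_of_real 0 = 0"
    by (auto simp: oct_arith)
  have "map_oct complex_of_real (sum f S) = (\<Sum>k\<in>S. map_oct complex_of_real (f k))" 
    if "finite S" for f and S :: "'c set"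
    using that by induction (auto simp: add zero)
  then show ?thesis
    by (auto simp: vec_eq_iff complexify_def omult_def mult)
qed

end

theory Submission
  imports Defs
begin

text \<open>An \<open>\<alpha>\<close> in the intersection commutes with \<open>\<tau>\<close> and \<open>\<gamma>\<close>. Write a Hermitian Cayley matrix as \<open>M + a\<close>, with
  \<open>M\<close> a Hermitian quaternionic matrix and \<open>a\<close> a quaternionic row holding the \<open>e\<^sub>4\<close>-coordinates; \<open>(P, A)\<close> acts by
  \<open>M + a \<mapsto> A M A\<^sup>* + P a A\<^sup>*\<close>. As \<open>det (M + a) = det M - tr (a M a\<^sup>*)\<close> and
  \<open>(M + a, N + b) = tr (M N) + 2 tr (a b\<^sup>*)\<close>, real traces, this action lies in \<open>E\<^sub>6\<close>.
  Conversely \<open>\<alpha> (M + a) = f M + g a\<close> for real \<open>M\<close> and \<open>a\<close>; polarising the invariance of \<open>tr (a M a\<^sup>*)\<close> gives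
  \<open>g (a M) = g a f M\<close>. So \<open>g\<close> conjugates left multiplications by quaternions to maps that commute
  with all Hermitian matrices, i.e. to left multiplications again. Automorphisms of the quaternions
  being inner, \<open>g a = P a B\<close>, and then \<open>f M = B\<^sup>* M B\<close>. The homeomorphism is automatic, from a compact
  to a Hausdorff space.\<close>

section \<open>Quaternions and quaternionic matrices\<close>

lemma qre_simps [simp]:
  "qre 0 = 0" "qi 0 = 0" "qj 0 = 0" "qk 0 = 0"
  "qre (x + y) = qre x + qre y" "qi (x + y) = qi x + qi y"
  "qj (x + y) = qj x + qj y" "qk (x + y) = qk x + qk y"
  "qre (x - y) = qre x - qre y" "qi (x - y) = qi x - qi y"
  "qj (x - y) = qj x - qj y" "qk (x - y) = qk x - qk y"
  "qre (- x) = - qre x" "qi (- x) = - qi x" "qj (- x) = - qj x" "qk (- x) = - qk x"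
  for x y :: "'a::ab_group_add quat"
  by (simp_all add: zero_quat_def plus_quat_def minus_quat_def uminus_quat_def)

lemma qre_one [simp]: "qre 1 = (1::'a::comm_ring_1)" "qi 1 = (0::'a)" "qj 1 = (0::'a)" "qk 1 = (0::'a)"
  by (simp_all add: one_quat_def)

lemma qre_mult [simp]:
  fixes x y :: "'a::comm_ring_1 quat"
  shows "qre (x * y) = qre x * qre y - qi x * qi y - qj x * qj y - qk x * qk y"
    "qi (x * y) = qre x * qi y + qi x * qre y + qj x * qk y - qk x * qj y"
    "qj (x * y) = qre x * qj y - qi x * qk y + qj x * qre y + qk x * qi y"
    "qk (x * y) = qre x * qk y + qi x * qj y - qj x * qi y + qk x * qre y"
  by (simp_all add: times_quat_def)

lemma qre_qcnj [simp]: "qre (qcnj x) = qre x" "qi (qcnj x) = - qi x" "qj (qcnj x) = - qj x" "qk (qcnj x) = - qk x"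
  by (simp_all add: qcnj_def)

lemma qcnj_simps [simp]:
  "qcnj (qcnj x) = x" "qcnj 0 = 0"
  "qcnj (x + y) = qcnj x + qcnj y" "qcnj (x - y) = qcnj x - qcnj y" "qcnj (- x) = - qcnj x"
  by (simp_all add: quat_eq_iff)

lemma qcnj_one [simp]: "qcnj (1::'a::comm_ring_1 quat) = 1"
  by (simp add: quat_eq_iff)

lemma qcnj_mult: "qcnj (x * y) = qcnj y * qcnj (x::'a::comm_ring_1 quat)"
  by (simp add: quat_eq_iff algebra_simps)

lemma qcnj_sum: "qcnj (sum f A) = (\<Sum>x\<in>A. qcnj (f x))"
  by (induction A rule: infinite_finite_induct) auto

lemma quat_sum_sel:
  "qre (sum f A) = (\<Sum>x\<in>A. qre (f x))" "qi (sum f A) = (\<Sum>x\<in>A. qi (f x))"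
  "qj (sum f A) = (\<Sum>x\<in>A. qj (f x))" "qk (sum f A) = (\<Sum>x\<in>A. qk (f x))"
  by (induction A rule: infinite_finite_induct; simp)+

section \<open>Central scalars and the trace form on quaternionic matrices\<close>

definition qscal :: "'a::comm_ring_1 \<Rightarrow> 'a quat" where
  "qscal c = Quat c 0 0 0"

lemma qscal_sel [simp]: "qre (qscal c) = c" "qi (qscal c) = 0" "qj (qscal c) = 0" "qk (qscal c) = 0"
  by (simp_all add: qscal_def)

lemma qscal_commute: "x * qscal c = qscal c * x"
  by (simp add: quat_eq_iff algebra_simps)

lemma qscal_eqs: "qscal 1 = 1" "qscal 0 = 0" "qscal (c * d) = qscal c * qscal d"
   "qcnj (qscal c) = qscal c"
  by (simp_all add: quat_eq_iff)

text \<open>Keeping only the scalar part makes the trace cyclic, although the quaternions do not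
  commute.\<close>

definition mtr :: "'a::comm_ring_1 quat^'n^'n \<Rightarrow> 'a" where
  "mtr M = (\<Sum>i\<in>UNIV. qre (M $ i $ i))"

lemma mtr_simps:
  "mtr (M + N) = mtr M + mtr N" "mtr (M - N) = mtr M - mtr N" "mtr (- M) = - mtr M"
  "mtr 0 = 0" 
  by (simp_all add: mtr_def sum.distrib sum_subtractf sum_negf)

lemma mtr_mult_commute: 
  fixes M :: "'a::comm_ring_1 quat^'n^'m" and N :: "'a quat^'m^'n"
  shows "mtr (M ** N) = mtr (N ** M)"
proof -
  have "mtr (M ** N) = (\<Sum>i\<in>UNIV. \<Sum>k\<in>UNIV. qre (M $ i $ k * N $ k $ i))"
    by (simp add: mtr_def matrix_matrix_mult_def quat_sum_sel)
  also have "\<dots> = (\<Sum>k\<in>UNIV. \<Sum>i\<in>UNIV. qre (N $ k $ i * M $ i $ k))"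
    by (subst sum.swap) (simp add: algebra_simps)
  also have "\<dots> = mtr (N ** M)"
    by (simp add: mtr_def matrix_matrix_mult_def quat_sum_sel)
  finally show ?thesis .
qed

lemma mtr_qadj [simp]: "mtr (qadj M) = mtr M"
  by (simp add: mtr_def qadj_def)

lemma qadj_qadj [simp]: "qadj (qadj M) = M"
  by (simp add: qadj_def vec_eq_iff)

lemma qadj_mult: 
  fixes M :: "'a::comm_ring_1 quat^'n^'m"
  shows "qadj (M ** N) = qadj N ** qadj M"
  by (simp add: qadj_def vec_eq_iff matrix_matrix_mult_def qcnj_sum qcnj_mult)

lemma qadj_simps [simp]:
  "qadj (M + N) = qadj M + qadj N" "qadj (M - N) = qadj M - qadj N" "qadj (- M) = - qadj M" "qadj 0 = 0"
  by (simp_all add: qadj_def vec_eq_iff)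

lemma qadj_mat_1 [simp]: "qadj (mat 1) = (mat 1 :: 'a::comm_ring_1 quat^'n^'n)"
  by (simp add: qadj_def vec_eq_iff mat_def)

lemma matrix_minus_simps:
  fixes A B :: "'a::ring_1^'n^'m"
  shows "(- A) ** C = - (A ** C)" "D ** (- B) = - (D ** B)"
   "(A - B) ** C = A ** C - B ** C" "D ** (A - B) = D ** A - D ** B" "0 ** C = 0" "D ** 0 = (0 :: 'a^'n^'k)"
  by (simp_all add: vec_eq_iff matrix_matrix_mult_def sum_negf algebra_simps sum_subtractf)

lemma mtr_adj_self:
  fixes M :: "real quat^'n^'m"
  shows "mtr (M ** qadj M) = (\<Sum>i\<in>UNIV. \<Sum>j\<in>UNIV. (qre (M$i$j))\<^sup>2 + (qi (M$i$j))\<^sup>2 + (qj (M$i$j))\<^sup>2 + (qk (M$i$j))\<^sup>2)"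
  by (simp add: mtr_def matrix_matrix_mult_def qadj_def quat_sum_sel power2_eq_square)

text \<open>The trace is a sum of squares of coordinates, so positivity forces all of them to
  vanish; this is where real coefficients matter.\<close>

lemma mtr_adj_self_eq_0:
  fixes M :: "real quat^'n^'m"
  assumes "mtr (M ** qadj M) = 0"
  shows "M = 0"
proof -
  let ?n = "\<lambda>i j. (qre (M$i$j))\<^sup>2 + (qi (M$i$j))\<^sup>2 + (qj (M$i$j))\<^sup>2 + (qk (M$i$j))\<^sup>2"
  have "(\<Sum>j\<in>UNIV. ?n i j) = 0" for i
    using assms unfolding mtr_adj_self by (subst (asm) sum_nonneg_eq_0_iff) (auto intro!: sum_nonneg)
  then have "?n i j = 0" for i j
    by (subst (asm) sum_nonneg_eq_0_iff) (auto intro!: sum_nonneg)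
  then have "qre (M$i$j) = 0 \<and> qi (M$i$j) = 0 \<and> qj (M$i$j) = 0 \<and> qk (M$i$j) = 0" for i j
    by (simp add: add_nonneg_eq_0_iff)
  then show ?thesis
    by (simp add: vec_eq_iff quat_eq_iff)
qed

lemma mtr_nondegenerate:
  fixes x y :: "real quat^'n^'m"
  assumes "\<And>z. mtr (x ** qadj z) = mtr (y ** qadj z)"
  shows "x = y"
proof -
  have "mtr ((x - y) ** qadj (x - y)) = 0"
    using assms[of "x - y"] by (simp add: matrix_minus_simps mtr_simps del: qadj_simps)
  then show ?thesis using mtr_adj_self_eq_0[of "x - y"] by simp
qed

text \<open>The matrix \<open>1 - A\<^sup>* A\<close> is a Hermitian idempotent of trace \<open>0\<close>.\<close>

lemma qadj_mult_self:
  fixes A :: "real quat^'n^'n"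
  assumes "A ** qadj A = mat 1"
  shows "qadj A ** A = mat 1"
proof -
  define Q where "Q = mat 1 - qadj A ** A"
  have "qadj A ** A ** (qadj A ** A) = qadj A ** (A ** qadj A) ** A"
    by (simp only: matrix_mul_assoc)
  then have "Q ** qadj Q = Q"
    by (simp add: Q_def qadj_mult matrix_minus_simps assms)
  moreover have "mtr Q = 0"
    using arg_cong[OF assms, of mtr] by (simp add: Q_def mtr_simps mtr_mult_commute[of A])
  ultimately have "Q = 0" using mtr_adj_self_eq_0[of Q] by simp
  then show ?thesis by (simp add: Q_def)
qed

lemma Sp_group: "group (Sp :: (real quat^'n^'n) monoid)"
proof (rule groupI)
  fix A B :: "real quat^'n^'n"
  assume "A \<in> carrier Sp" "B \<in> carrier Sp"
  then have "A ** (B ** qadj B) ** qadj A = mat 1" by (simp add: Sp_def)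
  then show "A \<otimes>\<^bsub>Sp\<^esub> B \<in> carrier Sp" by (simp add: Sp_def qadj_mult matrix_mul_assoc)
next
  fix A :: "real quat^'n^'n"
  assume "A \<in> carrier Sp"
  then have "qadj A \<in> carrier Sp" "qadj A \<otimes>\<^bsub>Sp\<^esub> A = \<one>\<^bsub>Sp\<^esub>" by (auto simp: Sp_def qadj_mult_self)
  then show "\<exists>B\<in>carrier Sp. B \<otimes>\<^bsub>Sp\<^esub> A = \<one>\<^bsub>Sp\<^esub>" by blast
qed (auto simp: Sp_def matrix_mul_assoc)

section \<open>Splitting Cayley matrices into a quaternionic and a row part\<close>

lemma oct_sel_simps [simp]:
  "hpart 0 = 0" "epart 0 = 0"
  "hpart (x + y) = hpart x + hpart y" "epart (x + y) = epart x + epart y"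
  "hpart (x - y) = hpart x - hpart y" "epart (x - y) = epart x - epart y"
  "hpart (- x) = - hpart x" "epart (- x) = - epart x"
  "hpart (ocnj x) = qcnj (hpart x)" "epart (ocnj x) = - epart x"
  for x y :: "'a::ab_group_add oct"
  by (simp_all add: zero_oct_def plus_oct_def minus_oct_def uminus_oct_def ocnj_def)

lemma oct_sel_one [simp]: "hpart 1 = (1 :: 'a::comm_ring_1 quat)" "epart 1 = (0 :: 'a quat)"
  by (simp_all add: one_oct_def)

lemma oct_sel_mult [simp]:
  fixes x y :: "'a::comm_ring_1 oct"
  shows "hpart (x * y) = hpart x * hpart y - qcnj (epart y) * epart x"
    "epart (x * y) = epart x * qcnj (hpart y) + epart y * hpart x"
  by (simp_all add: times_oct_def)

definition quat_scale :: "'a::comm_ring_1 \<Rightarrow> 'a quat^'n^'m \<Rightarrow> 'a quat^'n^'m" where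
  "quat_scale c M = (\<chi> i j. qscal c * M $ i $ j)"

lemma quat_scale_nth [simp]: "quat_scale c M $ i $ j = qscal c * M $ i $ j"
  by (simp add: quat_scale_def)

lemma qscal_left_commute: "x * (qscal c * y) = qscal c * (x * y)"
  by (metis mult.assoc qscal_commute)

lemma quat_scale_mult [simp]:
  fixes A :: "'a::comm_ring_1 quat^'n^'m"
  shows "quat_scale c A ** B = quat_scale c (A ** B)" "D ** quat_scale c A = quat_scale c (D ** A)"
  by (simp_all add: vec_eq_iff matrix_matrix_mult_def sum_distrib_left mult.assoc qscal_left_commute)

lemma quat_scale_simps [simp]:
  fixes A :: "'a::comm_ring_1 quat^'n^'m"
  shows "quat_scale 1 A = A" "quat_scale c (quat_scale d A) = quat_scale (c * d) A"
  "quat_scale c (A + B) = quat_scale c A + quat_scale c B" "quat_scale c (A - B) = quat_scale c A - quat_scale c B" "quat_scale c (- A) = - quat_scale c A"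
  "quat_scale c 0 = (0 :: 'a quat^'n^'m)"
  by (simp_all add: vec_eq_iff qscal_eqs mult.assoc distrib_left right_diff_distrib)

lemma qadj_quat_scale [simp]: "qadj (quat_scale c A) = quat_scale c (qadj A)"
  by (simp add: vec_eq_iff qadj_def qcnj_mult qscal_eqs qscal_commute)

lemma mtr_quat_scale [simp]: "mtr (quat_scale c M) = c * mtr M"
  by (simp add: mtr_def sum_distrib_left)

text \<open>The \<open>e\<^sub>4\<close>-coordinates of a Hermitian Cayley matrix form a skew matrix, encoded as the row of its
  entries \<open>(2, 3)\<close>, \<open>(3, 1)\<close>, \<open>(1, 2)\<close>.\<close>

definition skew :: "'a::ab_group_add quat^3^1 \<Rightarrow> 'a quat^3^3" where
  "skew a = vector [vector [0, a $ 1 $ 3, - a $ 1 $ 2], vector [- a $ 1 $ 3, 0, a $ 1 $ 1],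
     vector [a $ 1 $ 2, - a $ 1 $ 1, 0]]"

definition oct_matrix :: "'a::ab_group_add quat^3^3 \<Rightarrow> 'a quat^3^1 \<Rightarrow> 'a oct^3^3" where
  "oct_matrix M a = (\<chi> i j. Oct (M $ i $ j) (skew a $ i $ j))"

definition quat_part :: "'a oct^3^3 \<Rightarrow> 'a quat^3^3" where
  "quat_part X = (\<chi> i j. hpart (X $ i $ j))"

definition row_part :: "'a::ab_group_add oct^3^3 \<Rightarrow> 'a quat^3^1" where
  "row_part X = vector [vector [epart (X $ 2 $ 3), epart (X $ 3 $ 1), epart (X $ 1 $ 2)]]"

lemma skew_nth [simp]:
  "skew a $ 1 $ 1 = 0" "skew a $ 1 $ 2 = a $ 1 $ 3" "skew a $ 1 $ 3 = - a $ 1 $ 2"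
  "skew a $ 2 $ 1 = - a $ 1 $ 3" "skew a $ 2 $ 2 = 0" "skew a $ 2 $ 3 = a $ 1 $ 1"
  "skew a $ 3 $ 1 = a $ 1 $ 2" "skew a $ 3 $ 2 = - a $ 1 $ 1" "skew a $ 3 $ 3 = 0"
  by (simp_all add: skew_def)

lemma oct_matrix_nth [simp]: "oct_matrix M a $ i $ j = Oct (M $ i $ j) (skew a $ i $ j)"
  by (simp add: oct_matrix_def)

lemma quat_part_nth [simp]: "quat_part X $ i $ j = hpart (X $ i $ j)"
  by (simp add: quat_part_def)

lemma row_part_nth [simp]:
  "row_part X $ 1 $ 1 = epart (X $ 2 $ 3)" "row_part X $ 1 $ 2 = epart (X $ 3 $ 1)" "row_part X $ 1 $ 3 = epart (X $ 1 $ 2)"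
  by (simp_all add: row_part_def)

lemma quat_part_oct_matrix [simp]: "quat_part (oct_matrix M a) = M" and row_part_oct_matrix [simp]: "row_part (oct_matrix M a) = a"
  by (simp_all add: vec_eq_iff forall_3)

lemma oct_matrix_inject [simp]: "oct_matrix M a = oct_matrix N b \<longleftrightarrow> M = N \<and> a = b"
  by (metis quat_part_oct_matrix row_part_oct_matrix)

text \<open>Since \<open>ocnj\<close> negates the e4-part and \<open>skew\<close> is antisymmetric,
  the row is unconstrained.\<close>

lemma oct_matrix_in_JC_iff [simp]: "oct_matrix M a \<in> JC \<longleftrightarrow> qadj M = M"
  by (simp add: mem_JC_iff oadj_def qadj_def vec_eq_iff forall_3 oct_eq_iff)

lemma complex_quat_eq_minus: "x = - x \<longleftrightarrow> x = (0 :: complex quat)"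
  by (simp add: quat_eq_iff)

text \<open>Being Hermitian makes the e4-coordinates antisymmetric; those on the diagonal equal
  their own negatives and vanish, so three of them determine the rest.\<close>

lemma oct_matrix_quat_part_row_part:
  assumes "X \<in> JC"
  shows "oct_matrix (quat_part X) (row_part X) = X" 
  using assms by (simp add: mem_JC_iff oadj_def vec_eq_iff forall_3 oct_eq_iff complex_quat_eq_minus)
    (metis complex_quat_eq_minus)

lemma JC_cases:
  assumes "X \<in> JC"
  obtains M a where "X = oct_matrix M a" "qadj M = M"
  by (metis oct_matrix_quat_part_row_part[OF assms] assms oct_matrix_in_JC_iff)

lemma oct_matrix_add: "oct_matrix M a + oct_matrix N b = oct_matrix (M + N) (a + b)"
  and oct_matrix_diff: "oct_matrix M a - oct_matrix N b = oct_matrix (M - N) (a - b)"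
  by (simp_all add: vec_eq_iff forall_3 oct_eq_iff)

lemma cscale_oct_matrix: "cscale c (oct_matrix M a) = oct_matrix (quat_scale c M) (quat_scale c a)"
  by (simp add: cscale_def vec_eq_iff forall_3 oct_eq_iff quat_eq_iff oct.map_sel quat.map_sel)

lemma mat_1_eq_oct_matrix: "(mat 1 :: 'a::comm_ring_1 oct^3^3) = oct_matrix (mat 1) 0"
  by (simp add: vec_eq_iff forall_3 oct_eq_iff mat_def)

section \<open>Trace, inner product and determinant in split coordinates\<close>

lemma jtr_oct_matrix: "jtr (oct_matrix M a) = mtr M"
  by (simp add: jtr_def mtr_def)

text \<open>Each entry of a row occurs twice in \<open>skew\<close>, above and below the diagonal,
  hence the factor 2.\<close>

lemma jinner_oct_matrix: "jinner (oct_matrix M a) (oct_matrix N b) = mtr (M ** N) + 2 * mtr (a ** qadj b)"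
  by (simp add: jinner_def jprod_def jtr_def mtr_def cscale_def omult_def oct.map_sel quat.map_sel
     matrix_matrix_mult_def sum_3 sum_1 qadj_def algebra_simps)

lemma hermitian_diag:
  assumes "qadj M = (M :: complex quat^'n^'n)"
  shows "M $ i $ i = qscal (qre (M $ i $ i))"
proof -
  have "qcnj (M $ i $ i) = M $ i $ i"
    using arg_cong[OF assms, of "\<lambda>M. M $ i $ i"] by (simp add: qadj_def)
  then show ?thesis by (simp add: quat_eq_iff)
qed

lemma hermitian_flip:
  assumes "qadj M = M"
  shows "qcnj (M $ i $ j) = M $ j $ i"
  using arg_cong[OF assms, of "\<lambda>M. M $ j $ i"] by (simp add: qadj_def)

text \<open>The determinant involves full Cayley products only in the form of squares, so this is
  the product worth computing in closed form.\<close>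

lemma omult_self_oct_matrix:
  fixes M :: "complex quat^3^3"
  assumes "qadj M = M"
  shows "omult (oct_matrix M a) (oct_matrix M a) =
    oct_matrix (M ** M + quat_scale (mtr (a ** qadj a)) (mat 1) - qadj a ** a) (quat_scale (mtr M) a - a ** M)"
proof -
  \<comment> \<open>Three scalars and three quaternions parametrise \<open>M\<close>; the claim then
    becomes a family of polynomial identities.\<close>
  obtain r s t where d: "M $ 1 $ 1 = qscal r" "M $ 2 $ 2 = qscal s" "M $ 3 $ 3 = qscal t"
    using hermitian_diag[OF assms] by metis
  define u v w where uvw: "u = M $ 1 $ 2" "v = M $ 1 $ 3" "w = M $ 2 $ 3"
  have e: "M $ 1 $ 2 = u" "M $ 1 $ 3 = v" "M $ 2 $ 3 = w" 
    "M $ 2 $ 1 = qcnj u" "M $ 3 $ 1 = qcnj v" "M $ 3 $ 2 = qcnj w"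
    using hermitian_flip[OF assms] by (auto simp: uvw)
  show ?thesis
    by (simp add: vec_eq_iff forall_3 omult_def sum_3 sum_1 oct_eq_iff matrix_matrix_mult_def
       mtr_def qadj_def mat_def d e)
      (simp add: quat_eq_iff algebra_simps)
qed

section \<open>The action of the symplectic groups\<close>

lemma matrix_add_rdistrib: "(A + B) ** C = A ** C + B ** (C :: 'a::semiring_1^'n^'m)"
  by (simp add: vec_eq_iff matrix_matrix_mult_def distrib_right sum.distrib)

lemma jprod_self_oct_matrix:
  fixes M :: "complex quat^3^3"
  assumes "qadj M = M"
  shows "jprod (oct_matrix M a) (oct_matrix M a) =
    oct_matrix (M ** M + quat_scale (mtr (a ** qadj a)) (mat 1) - qadj a ** a) (quat_scale (mtr M) a - a ** M)"
proof -
  have half: "cscale (1/2) (X + X) = X" for X :: "complex oct^3^3"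
    by (simp add: cscale_def vec_eq_iff oct_eq_iff quat_eq_iff oct.map_sel quat.map_sel)
  show ?thesis by (simp add: jprod_def half omult_self_oct_matrix[OF assms])
qed

text \<open>Newton's formula for the third elementary symmetric function in terms of traces of
  powers. Written with traces alone, it is visibly invariant under conjugation.\<close>

definition qdet :: "complex quat^3^3 \<Rightarrow> complex" where
  "qdet M = (mtr (M ** M ** M) - mtr M * mtr (M ** M) + (mtr M ^ 2 - mtr (M ** M)) * mtr M / 2) / 3"

lemma mtr_mat_1 [simp]: "mtr (mat 1 :: 'a::comm_ring_1 quat^3^3) = 3"
  by (simp add: mtr_def mat_def)

text \<open>In \<open>jcross X X\<close> the multiples of \<open>a\<close> and of
  \<open>mtr (a ** qadj a)\<close> cancel; \<open>a\<close> contributes \<open>- qadj a ** a\<close>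
  to the quaternionic part and \<open>- a ** M\<close> to the row. Pairing with \<open>X\<close>
  gives the last term three times, by cyclicity.\<close>

lemma jdet_oct_matrix:
  assumes "qadj M = M"
  shows "jdet (oct_matrix M a) = qdet M - mtr (a ** M ** qadj a)"
proof -
  have "mtr (M ** (qadj a ** a)) = mtr (a ** M ** qadj a)"
    by (metis mtr_mult_commute matrix_mul_assoc)
  moreover have "mtr (a ** qadj (a ** M)) = mtr (a ** M ** qadj a)"
    by (simp add: qadj_mult assms matrix_mul_assoc)
  ultimately show ?thesis
    unfolding jdet_def jcross_def
    by (simp add: jprod_self_oct_matrix[OF assms] cscale_oct_matrix oct_matrix_diff oct_matrix_add mat_1_eq_oct_matrix jtr_oct_matrix jinner_oct_matrix
        matrix_minus_simps matrix_add_ldistrib mtr_simps matrix_mul_assoc)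
     (simp add: qdet_def mtr_simps field_simps power2_eq_square)
qed

section \<open>Real quaternionic matrices inside the complexified ones\<close>

definition mat_complex :: "real quat^'n^'m \<Rightarrow> complex quat^'n^'m" where
  "mat_complex A = map_matrix (map_quat complex_of_real) A"

definition mat_cnj :: "complex quat^'n^'m \<Rightarrow> complex quat^'n^'m" where
  "mat_cnj A = map_matrix (map_quat cnj) A"

lemma mat_complex_nth: "mat_complex A $ i $ j = map_quat complex_of_real (A $ i $ j)"
  by (simp add: mat_complex_def)

lemma mat_cnj_nth: "mat_cnj A $ i $ j = map_quat cnj (A $ i $ j)"
  by (simp add: mat_cnj_def)

lemma mat_complex_simps [simp]:
  "mat_complex (A + B) = mat_complex A + mat_complex B" "mat_complex (- A) = - mat_complex A" "mat_complex 0 = 0" 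
  "mat_complex (qadj A) = qadj (mat_complex A)" "mat_complex (quat_scale r A) = quat_scale (complex_of_real r) (mat_complex A)"
  "mat_complex A = mat_complex B \<longleftrightarrow> A = B"
  by (simp_all add: vec_eq_iff mat_complex_nth qadj_def quat_eq_iff quat.map_sel)

lemma mat_complex_mat_1 [simp]: "mat_complex (mat 1) = mat 1"
  by (simp add: vec_eq_iff mat_complex_nth mat_def quat_eq_iff quat.map_sel)

lemma mat_complex_mult [simp]: "mat_complex (A ** B) = mat_complex A ** mat_complex B"
  by (simp add: vec_eq_iff mat_complex_nth matrix_matrix_mult_def quat_eq_iff quat.map_sel quat_sum_sel)

lemma mtr_mat_complex [simp]: "mtr (mat_complex A) = complex_of_real (mtr A)"
  by (simp add: mtr_def mat_complex_nth quat.map_sel)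

lemma mat_cnj_simps [simp]:
  "mat_cnj (qadj A) = qadj (mat_cnj A)" "mat_cnj (mat_complex B) = mat_complex B" "mat_cnj 0 = 0"
  by (simp_all add: vec_eq_iff mat_cnj_nth mat_complex_nth qadj_def quat_eq_iff quat.map_sel)

lemma mat_cnj_mult [simp]: "mat_cnj (A ** B) = mat_cnj A ** mat_cnj B"
  by (simp add: vec_eq_iff mat_cnj_nth matrix_matrix_mult_def quat_eq_iff quat.map_sel quat_sum_sel)

lemma mat_cnj_fixed:
  assumes "mat_cnj A = A"
  obtains B where "A = mat_complex B"
proof
  show "A = mat_complex (map_matrix (map_quat Re) A)"
    using assms by (simp add: vec_eq_iff mat_cnj_nth mat_complex_nth quat_eq_iff quat.map_sel complex_eq_iff)
qed

lemma tau_oct_matrix: "tau (oct_matrix M a) = oct_matrix (mat_cnj M) (mat_cnj a)"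
  by (simp add: tau_def vec_eq_iff forall_3 oct_eq_iff quat_eq_iff oct.map_sel quat.map_sel mat_cnj_nth)

lemma gamma_oct_matrix: "qadj M = M \<Longrightarrow> gamma (oct_matrix M a) = oct_matrix M (- a)"
  by (simp add: gamma_def vec_eq_iff forall_3 oct_eq_iff)

section \<open>The action of pairs, and its image in the fixed subgroup\<close>

definition phi :: "(real quat^1^1) \<times> (real quat^3^3) \<Rightarrow> complex oct^3^3 \<Rightarrow> complex oct^3^3" where
  "phi = (\<lambda>(P, A). \<lambda>X\<in>JC. oct_matrix (mat_complex A ** quat_part X ** qadj (mat_complex A)) (mat_complex P ** row_part X ** qadj (mat_complex A)))"

lemma phi_oct_matrix:
  "qadj M = M \<Longrightarrow> phi (P, A) (oct_matrix M a) = oct_matrix (mat_complex A ** M ** qadj (mat_complex A)) (mat_complex P ** a ** qadj (mat_complex A))"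
  by (simp add: phi_def)

lemma qadj_conj: "qadj M = M \<Longrightarrow> qadj (B ** M ** qadj B) = B ** M ** qadj B"
  by (simp add: qadj_mult matrix_mul_assoc)

lemma phi_in_JC: "X \<in> JC \<Longrightarrow> phi (P, A) X \<in> JC"
  by (erule JC_cases) (simp add: phi_oct_matrix qadj_conj)

lemma phi_phi:
  assumes "X \<in> JC"
  shows "phi (P, A) (phi (Q, B) X) = phi (P ** Q, A ** B) X"
  using assms by (elim JC_cases) (simp add: phi_oct_matrix qadj_conj qadj_mult matrix_mul_assoc)

lemma phi_one:
  assumes "X \<in> JC"
  shows "phi (mat 1, mat 1) X = X"
  using assms by (elim JC_cases) (simp add: phi_oct_matrix)

lemma Sp_D:
  assumes "A \<in> carrier (Sp :: (real quat^'n^'n) monoid)"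
  shows "A ** qadj A = mat 1" "qadj A ** A = mat 1" "qadj A \<in> carrier Sp"
  using assms by (auto simp: Sp_def qadj_mult_self)

lemma phi_Bij:
  assumes "P \<in> carrier Sp" "A \<in> carrier Sp"
  shows "phi (P, A) \<in> Bij JC"
proof -
  have "bij_betw (phi (P, A)) JC JC"
    by (rule bij_betw_byWitness[where f' = "phi (qadj P, qadj A)"])
      (auto simp: phi_in_JC phi_phi Sp_D[OF assms(1)] Sp_D[OF assms(2)] phi_one)
  moreover have "phi (P, A) \<in> extensional JC" by (simp add: phi_def)
  ultimately show ?thesis by (simp add: Bij_def)
qed

lemma mult_qadj_cancel:
  fixes B :: "'a::comm_ring_1 quat^'n^'n"
  assumes "qadj B ** B = mat 1"
  shows "(X ** qadj B) ** (B ** Y) = X ** Y" "Z ** qadj B ** B = Z"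
  by (metis assms matrix_mul_assoc matrix_mul_rid matrix_mul_lid)+

lemma mtr_conj:
  fixes B :: "'a::comm_ring_1 quat^'n^'n"
  assumes "qadj B ** B = mat 1"
  shows "mtr (B ** M ** qadj B) = mtr M"
  by (metis assms mtr_mult_commute matrix_mul_assoc matrix_mul_lid)

lemma conj_mult:
  fixes B :: "'a::comm_ring_1 quat^'n^'n"
  assumes "qadj B ** B = mat 1"
  shows "(B ** M ** qadj B) ** (B ** N ** qadj B) = B ** (M ** N) ** qadj B"
  by (simp add: matrix_mul_assoc mult_qadj_cancel[OF assms])

lemma mat_complex_Sp:
  assumes "A \<in> carrier (Sp :: (real quat^'n^'n) monoid)"
  shows "qadj (mat_complex A) ** mat_complex A = mat 1"
  using Sp_D(2)[OF assms] by (metis mat_complex_mult mat_complex_simps(4) mat_complex_mat_1)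

lemma phi_in_E6:
  assumes "P \<in> carrier Sp" "A \<in> carrier Sp"
  shows "phi (P, A) \<in> E6"
proof -
  note B = mat_complex_Sp[OF assms(2)] and Q = mat_complex_Sp[OF assms(1)]
  have "phi (P, A) (X + Y) = phi (P, A) X + phi (P, A) Y" if "X \<in> JC" "Y \<in> JC" for X Y
    using that by (elim JC_cases) (simp add: phi_oct_matrix oct_matrix_add matrix_add_ldistrib matrix_add_rdistrib)
  moreover have "phi (P, A) (cscale c X) = cscale c (phi (P, A) X)" if "X \<in> JC" for c X
    using that by (elim JC_cases) (simp add: phi_oct_matrix cscale_oct_matrix)
  moreover have "jdet (phi (P, A) X) = jdet X" if "X \<in> JC" for X
    using that
  proof (elim JC_cases)
    fix M a assume X: "X = oct_matrix M a" and M: "qadj M = M"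
    let ?N = "mat_complex A ** M ** qadj (mat_complex A)" and ?b = "mat_complex P ** a ** qadj (mat_complex A)"
    \<comment> \<open>The inner factors from \<open>A\<close> cancel, so the cubic term is merely
      conjugated by \<open>P\<close>, which preserves its trace.\<close>
    have "?b ** ?N ** qadj ?b = mat_complex P ** (a ** M ** qadj a) ** qadj (mat_complex P)"
      by (simp add: qadj_mult matrix_mul_assoc mult_qadj_cancel[OF B])
    then show ?thesis
      by (simp add: X phi_oct_matrix jdet_oct_matrix M qadj_conj conj_mult[OF B] mtr_conj[OF B] mtr_conj[OF Q] qdet_def)
  qed
  moreover have "jherm (phi (P, A) X) (phi (P, A) Y) = jherm X Y" if "X \<in> JC" "Y \<in> JC" for X Y
    using that
  proof (elim JC_cases)
    fix M a N b assume X: "X = oct_matrix M a" "qadj M = M" "Y = oct_matrix N b" "qadj N = N"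
    have "mat_complex P ** mat_cnj a ** qadj (mat_complex A) ** qadj (mat_complex P ** b ** qadj (mat_complex A)) = mat_complex P ** (mat_cnj a ** qadj b) ** qadj (mat_complex P)"
      by (simp add: qadj_mult matrix_mul_assoc mult_qadj_cancel[OF B])
    then show ?thesis
      by (simp add: X jherm_def phi_oct_matrix tau_oct_matrix jinner_oct_matrix conj_mult[OF B] mtr_conj[OF B] mtr_conj[OF Q])
  qed
  ultimately show ?thesis
    using phi_Bij[OF assms] by (simp add: E6_def Iso_C_def)
qed

lemma gamma_in_JC: "X \<in> JC \<Longrightarrow> gamma X \<in> JC"
  by (erule JC_cases) (simp add: gamma_oct_matrix)

lemma conj_gamma_eq_iff:
  assumes "\<alpha> \<in> E6"
  shows "compose JC gamma (compose JC \<alpha> gamma) = \<alpha> \<longleftrightarrow> (\<forall>X\<in>JC. gamma (\<alpha> (gamma X)) = \<alpha> X)"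
  using assms by (auto simp: E6_def Iso_C_def Bij_def compose_def fun_eq_iff gamma_in_JC extensional_def)

text \<open>Once \<gamma>\<alpha>\<gamma> = \<alpha>, the other condition
  \<lambda>(\<gamma>\<alpha>\<gamma>) = \<alpha> reads \<lambda>(\<alpha>) = \<alpha>, that is,
  \<alpha> commutes with \<tau>.\<close>

lemma mem_E6_lambda_gamma_Int_iff:
  "\<alpha> \<in> E6_lambda_gamma \<inter> E6_gamma \<longleftrightarrow>
    \<alpha> \<in> E6 \<and> (\<forall>X\<in>JC. gamma (\<alpha> (gamma X)) = \<alpha> X) \<and> (\<forall>X\<in>JC. tau (\<alpha> (tau X)) = \<alpha> X)"
proof -
  have "lambda \<alpha> = \<alpha> \<longleftrightarrow> (\<forall>X\<in>JC. tau (\<alpha> (tau X)) = \<alpha> X)" if "\<alpha> \<in> E6"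
    using that by (auto simp: E6_def Iso_C_def Bij_def lambda_def fun_eq_iff extensional_def)
  then show ?thesis
    unfolding E6_lambda_gamma_def E6_gamma_def Int_iff mem_Collect_eq by (metis conj_gamma_eq_iff)
qed

lemma phi_in_Int:
  assumes "P \<in> carrier Sp" "A \<in> carrier Sp"
  shows "phi (P, A) \<in> E6_lambda_gamma \<inter> E6_gamma"
proof -
  have "gamma (phi (P, A) (gamma X)) = phi (P, A) X" if "X \<in> JC" for X
    using that by (elim JC_cases) (simp add: gamma_oct_matrix phi_oct_matrix qadj_conj matrix_minus_simps)
  moreover have "tau (phi (P, A) (tau X)) = phi (P, A) X" if "X \<in> JC" for X
    using that
  proof (elim JC_cases)
    fix M a assume X: "X = oct_matrix M a" "qadj M = M"
    moreover have "mat_cnj (mat_cnj M) = M" "mat_cnj (mat_cnj a) = a"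
      by (simp_all add: vec_eq_iff mat_cnj_nth quat_eq_iff quat.map_sel)
    moreover have "qadj (mat_cnj M) = mat_cnj M" using X by (metis mat_cnj_simps(1))
    ultimately show ?thesis by (simp add: tau_oct_matrix phi_oct_matrix)
  qed
  ultimately show ?thesis
    using phi_in_E6[OF assms] by (simp only: mem_E6_lambda_gamma_Int_iff) blast
qed

section \<open>Quaternionic linear algebra\<close>

text \<open>The intertwiner is obtained by averaging over the quaternion group \<open>{\<plusminus>1, \<plusminus>i, \<plusminus>j, \<plusminus>k}\<close>:
  \<open>p = \<Sum> \<theta>(e) y e\<^sup>-\<^sup>1\<close>, where \<open>y\<close> is one of the basis quaternions with \<open>p \<noteq> 0\<close>.\<close>

lemma quat_endomorphism_inner:
  fixes \<theta> :: "real quat \<Rightarrow> real quat"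
  assumes add: "\<And>x y. \<theta> (x + y) = \<theta> x + \<theta> y" and mult: "\<And>x y. \<theta> (x * y) = \<theta> x * \<theta> y"
    and scal: "\<And>r. \<theta> (qscal r) = qscal r"
  obtains p where "p * qcnj p = 1" "\<And>x. \<theta> x * p = p * x"
proof -
  define I J K :: "real quat" where "I = Quat 0 1 0 0" and "J = Quat 0 0 1 0" and "K = Quat 0 0 0 1"
  have sel: "qre I = 0" "qi I = 1" "qj I = 0" "qk I = 0" "qre J = 0" "qi J = 0" "qj J = 1" "qk J = 0"
    "qre K = 0" "qi K = 0" "qj K = 0" "qk K = 1"
    by (simp_all add: I_def J_def K_def)
  define a b c where abc: "a = \<theta> I" "b = \<theta> J" "c = \<theta> K"
  have neg: "\<theta> (- x) = - \<theta> x" for x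
  proof -
    have "\<theta> (qscal (-1) * x) = qscal (-1) * \<theta> x" by (simp only: mult scal)
    moreover have "qscal (-1) * z = - z" for z :: "real quat" by (simp add: quat_eq_iff)
    ultimately show ?thesis by simp
  qed
  have tab: "I * I = - 1" "J * J = - 1" "K * K = - 1" "I * J = K" "J * I = - K" "J * K = I" "K * J = - I"
      "K * I = J" "I * K = - J"
    by (simp_all add: quat_eq_iff sel)
  have one: "\<theta> 1 = 1" using scal[of 1] by (simp add: qscal_eqs)
  have tab': "a * a = - 1" "b * b = - 1" "c * c = - 1" "a * b = c" "b * a = - c" "b * c = a" "c * b = - a"
      "c * a = b" "a * c = - b"
    unfolding abc mult[symmetric] tab neg one by simp_all
  have r: "x * (I * I) = - x" "x * (J * J) = - x" "x * (K * K) = - x" "x * (I * J) = x * K" "x * (J * I) = - (x * K)"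
     "x * (J * K) = x * I" "x * (K * J) = - (x * I)" "x * (K * I) = x * J" "x * (I * K) = - (x * J)" for x
    unfolding tab by simp_all
  have l: "a * (a * x) = - x" "b * (b * x) = - x" "c * (c * x) = - x" "a * (b * x) = c * x" "b * (a * x) = - (c * x)"
     "b * (c * x) = a * x" "c * (b * x) = - (a * x)" "c * (a * x) = b * x" "a * (c * x) = - (b * x)" for x
    unfolding mult.assoc[symmetric] tab' by simp_all
  \<comment> \<open>Opposite group elements contribute equally, so four terms suffice; the minus
    signs come from inverting \<open>I\<close>, \<open>J\<close>, \<open>K\<close>.\<close>
  define T where "T y = y - a * y * I - b * y * J - c * y * K" for y
  have TI: "a * T y = T y * I" and TJ: "b * T y = T y * J" and TK: "c * T y = T y * K" for y
    unfolding T_def by (simp_all add: left_diff_distrib right_diff_distrib mult.assoc l r)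
  have T: "\<theta> x * T y = T y * x" for x y
  proof -
    have x: "x = qscal (qre x) + qscal (qi x) * I + qscal (qj x) * J + qscal (qk x) * K"
      by (simp add: quat_eq_iff sel)
    have "\<theta> x = qscal (qre x) + qscal (qi x) * a + qscal (qj x) * b + qscal (qk x) * c"
      by (subst x) (simp only: add mult scal abc)
    then show ?thesis
      by (subst (2) x)
        (simp add: distrib_left distrib_right mult.assoc TI TJ TK qscal_left_commute qscal_commute[of "T y"])
  qed
  obtain y where y: "T y \<noteq> 0"
  proof -
    \<comment> \<open>This is the trace of the real-linear map \<open>T\<close>: the identity
      contributes 4, and each product with an imaginary unit on the right contributes 0.\<close>
    have "qre (T 1) + qi (T I) + qj (T J) + qk (T K) = 4"
      by (simp add: T_def sel)
    then have "T 1 \<noteq> 0 \<or> T I \<noteq> 0 \<or> T J \<noteq> 0 \<or> T K \<noteq> 0" by auto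
    then show thesis using that by blast
  qed
  define n where "n = (qre (T y))\<^sup>2 + (qi (T y))\<^sup>2 + (qj (T y))\<^sup>2 + (qk (T y))\<^sup>2"
  have n: "n > 0"
    using y by (auto simp: n_def quat_eq_iff add_nonneg_eq_0_iff less_le)
  define p where "p = qscal (1 / sqrt n) * T y"
  have "T y * qcnj (T y) = qscal n"
    by (simp add: quat_eq_iff n_def power2_eq_square)
  moreover have "p * qcnj p = qscal (1 / sqrt n) * (T y * qcnj (T y)) * qscal (1 / sqrt n)"
    by (simp add: p_def qcnj_mult qscal_eqs(4) mult.assoc)
  ultimately have "p * qcnj p = 1"
    using n by (simp add: quat_eq_iff)
  moreover have "\<theta> x * p = p * x" for x
    by (simp add: p_def T qscal_left_commute mult.assoc)
  ultimately show thesis by (rule that)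
qed

text \<open>Scalars acting on rows from the left are written as 1 x 1 matrices, so that
  associativity of matrix products covers them.\<close>

lemma mat_mult_row [simp]: "(mat q ** a) $ i $ j = q * (a :: 'a::comm_ring_1 quat^'n^1) $ i $ j"
  by (simp add: matrix_matrix_mult_def mat_def sum_1) (metis num1_eq1)

lemma mat_mult_mat: "(mat x :: 'a::comm_ring_1 quat^1^1) ** mat y = mat (x * y)"
  by (simp add: vec_eq_iff) (simp add: mat_def)

lemma mat_qscal_mult: "mat (qscal r) ** a = quat_scale r (a :: 'a::comm_ring_1 quat^'n^1)"
  by (simp add: vec_eq_iff)

text \<open>The row (1, 0, 0) is fixed by the projection \<open>E\<close>, so its image is a left
  multiple \<open>t\<close> of itself. Hermitian matrices carry this row, in two stages, to rows
  whose sums are all rows, and the multiplier \<open>t\<close> is transported along.\<close>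

lemma commutant_right_hermitian:
  fixes L :: "real quat^3^1 \<Rightarrow> real quat^3^1"
  assumes add: "\<And>a b. L (a + b) = L a + L b"
    and herm: "\<And>a M. qadj M = M \<Longrightarrow> L (a ** M) = L a ** M"
  obtains t where "\<And>a. L a = mat t ** a"
proof -
  define row :: "real quat \<Rightarrow> real quat \<Rightarrow> real quat \<Rightarrow> real quat^3^1"
    where "row x y z = vector [vector [x, y, z]]" for x y z
  define N1 N2 :: "real quat^3^1 \<Rightarrow> real quat^3^3" 
    where "N1 a = vector [vector [0, a $ 1 $ 2, a $ 1 $ 3], vector [qcnj (a $ 1 $ 2), 0, 0], vector [qcnj (a $ 1 $ 3), 0, 0]]"
     and "N2 a = vector [vector [0, qcnj (a $ 1 $ 1), 0], vector [a $ 1 $ 1, 0, 0], vector [0, 0, 0]]" for a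
  define E :: "real quat^3^3" where "E = vector [vector [1, 0, 0], vector [0, 0, 0], vector [0, 0, 0]]"
  define t where "t = L (row 1 0 0) $ 1 $ 1"
  note defs = row_def N1_def N2_def E_def
  have H: "qadj E = E" "qadj (N1 a) = N1 a" "qadj (N2 a) = N2 a" for a
    by (simp_all add: defs vec_eq_iff forall_3 qadj_def)
  have "L (row 1 0 0) = L (row 1 0 0 ** E)"
    by (rule arg_cong[of _ _ L]) (simp add: defs vec_eq_iff forall_3 matrix_matrix_mult_def sum_3)
  also have "\<dots> = L (row 1 0 0) ** E" by (rule herm) (rule H)
  also have "\<dots> = mat t ** row 1 0 0"
    by (simp add: vec_eq_iff forall_3) (simp add: t_def defs matrix_matrix_mult_def sum_3)
  finally have L1: "L (row 1 0 0) = mat t ** row 1 0 0" .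
  have L23: "L (row 0 y z) = mat t ** row 0 y z" for y z
  proof -
    have r: "row 0 y z = row 1 0 0 ** N1 (row 0 y z)"
      by (simp add: defs vec_eq_iff forall_3 matrix_matrix_mult_def sum_3)
    show ?thesis
      by (subst (1 2) r) (simp only: herm[OF H(2)] L1 matrix_mul_assoc)
  qed
  \<comment> \<open>The diagonal of a Hermitian matrix is real, so a general \<open>x\<close> in the
    first place is reached through (0, 1, 0).\<close>
  have L2: "L (row x 0 0) = mat t ** row x 0 0" for x
  proof -
    have r: "row x 0 0 = row 0 1 0 ** N2 (row x 0 0)"
      by (simp add: defs vec_eq_iff forall_3 matrix_matrix_mult_def sum_3)
    show ?thesis
      by (subst (1 2) r) (simp only: herm[OF H(3)] L23 matrix_mul_assoc)
  qed
  have "L a = mat t ** a" for a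
  proof -
    have "a = row (a $ 1 $ 1) 0 0 + row 0 (a $ 1 $ 2) (a $ 1 $ 3)"
      by (simp add: row_def vec_eq_iff forall_3)
    then show ?thesis by (metis add L2 L23 matrix_add_ldistrib)
  qed
  then show thesis by (rule that)
qed

lemma row_matrix_eqI:
  fixes X Y :: "'a::comm_ring_1 quat^'n^'m"
  assumes "\<And>a :: 'a quat^'m^1. a ** X = a ** Y"
  shows "X = Y"
proof -
  have "((\<chi> k j. if j = i then 1 else 0) ** Z) $ (1::1) $ j = Z $ i $ j" for Z :: "'a quat^'n^'m" and i j
    by (simp add: matrix_matrix_mult_def if_distrib[of "\<lambda>x. x * _"] sum.delta cong: if_cong)
  then show ?thesis
    using assms by (metis vec_eq_iff)
qed

lemma left_linear_row:
  fixes g :: "'a::comm_ring_1 quat^3^1 \<Rightarrow> 'a quat^3^1"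
  assumes add: "\<And>a b. g (a + b) = g a + g b" and lin: "\<And>q a. g (mat q ** a) = mat q ** g a"
  obtains B where "\<And>a. g a = a ** B"
proof
  define e :: "3 \<Rightarrow> 'a quat^3^1" where "e i = (\<chi> k j. if j = i then 1 else 0)" for i
  fix a
  have "a = mat (a$1$1) ** e 1 + mat (a$1$2) ** e 2 + mat (a$1$3) ** e 3"
    by (simp add: vec_eq_iff forall_3) (simp add: e_def)
  then have "g a = mat (a$1$1) ** g (e 1) + mat (a$1$2) ** g (e 2) + mat (a$1$3) ** g (e 3)"
    by (metis add lin)
  also have "\<dots> = a ** (\<chi> i. g (e i) $ 1)"
    by (simp add: vec_eq_iff) (simp add: matrix_matrix_mult_def sum_3)
  finally show "g a = a ** (\<chi> i. g (e i) $ 1)" .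
qed

text \<open>This is the real core of the converse: \<open>f\<close> and \<open>g\<close> stand for
  the restrictions of \<alpha> to Hermitian quaternionic matrices and to rows, \<open>inner\<close>
  comes from the Hermitian form and \<open>tri\<close> from the determinant.\<close>

lemma Sp_pair_of_invariant:
  fixes f :: "real quat^3^3 \<Rightarrow> real quat^3^3" and g :: "real quat^3^1 \<Rightarrow> real quat^3^1"
  assumes add: "\<And>a b. g (a + b) = g a + g b" and hom: "\<And>r a. g (quat_scale r a) = quat_scale r (g a)"
    and inner: "\<And>a b. mtr (g a ** qadj (g b)) = mtr (a ** qadj b)"
    and surj: "surj g"
    and f: "\<And>M. qadj M = M \<Longrightarrow> qadj (f M) = f M"
    and fsurj: "\<And>N. qadj N = N \<Longrightarrow> \<exists>M. qadj M = M \<and> f M = N"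
    and tri: "\<And>a M. qadj M = M \<Longrightarrow> mtr (g a ** f M ** qadj (g a)) = mtr (a ** M ** qadj a)"
  obtains P A where "P \<in> carrier Sp" "A \<in> carrier Sp" "\<And>a. g a = P ** a ** qadj A"
    "\<And>M. qadj M = M \<Longrightarrow> f M = A ** M ** qadj A"
proof -
  have inj: "inj g"
    by (rule injI, rule mtr_nondegenerate) (metis inner)
  have module: "g (a ** M) = g a ** f M" if M: "qadj M = M" for a M
  proof (rule mtr_nondegenerate)
    fix z
    obtain b where z: "z = g b" using surj by (metis surjD)
    have flip: "mtr (y ** N ** qadj x) = mtr (x ** N ** qadj y)" if "qadj N = N" for x y :: "real quat^3^1" and N
    proof -
      have "y ** N ** qadj x = qadj (x ** N ** qadj y)" by (simp add: qadj_mult matrix_mul_assoc that)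
      then show ?thesis by simp
    qed
    \<comment> \<open>Polarisation of \<open>tri\<close>; by \<open>flip\<close> the two mixed terms
      on each side coincide.\<close>
    have "mtr (g a ** f M ** qadj (g b)) + mtr (g b ** f M ** qadj (g a)) = mtr (a ** M ** qadj b) + mtr (b ** M ** qadj a)"
      using tri[OF M, of "a + b"]
      by (simp add: add matrix_add_ldistrib matrix_add_rdistrib mtr_simps tri[OF M])
    then have "mtr (g a ** f M ** qadj (g b)) = mtr (a ** M ** qadj b)"
      using flip[OF f[OF M], of "g a" "g b"] flip[OF M, of a b] by simp
    then show "mtr (g (a ** M) ** qadj z) = mtr (g a ** f M ** qadj z)"
      by (simp add: z inner)
  qed
  define h where "h = inv_into UNIV g"
  have gh: "h (g a) = a" "g (h a) = a" for a
    using inj surj by (simp_all add: h_def inv_f_f surj_f_inv_f)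
  have "\<exists>t. \<forall>a. g (mat q ** a) = mat t ** g a" for q
  proof -
    \<comment> \<open>Left multiplication by \<open>q\<close>, transported along \<open>g\<close>.
      It commutes with every Hermitian \<open>N\<close> because \<open>N\<close> is a value of
      \<open>f\<close>.\<close>
    define L where "L a = g (mat q ** h a)" for a
    have h_add: "h (a + b) = h a + h b" for a b
      by (metis add gh)
    have "L (a + b) = L a + L b" for a b
      by (simp add: L_def h_add add matrix_add_ldistrib)
    moreover have "L (a ** N) = L a ** N" if N: "qadj N = N" for a N
    proof -
      obtain M where M: "qadj M = M" "f M = N" using fsurj[OF N] by blast
      have "h (a ** N) = h a ** M"
        by (metis M module gh)
      then show ?thesis using M by (simp add: L_def matrix_mul_assoc module)
    qed
    ultimately have "\<exists>t. \<forall>a. L a = mat t ** a" by (rule commutant_right_hermitian[of L]) auto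
    then show ?thesis by (metis L_def gh(1))
  qed
  then obtain \<theta> where \<theta>: "\<And>q a. g (mat q ** a) = mat (\<theta> q) ** g a" by metis
  \<comment> \<open>A row with entries 1 recovers the multiplier; the laws for \<theta> are
    therefore tested at its preimage \<open>d\<close>.\<close>
  define e :: "real quat^3^1" where "e = (\<chi> i j. 1)"
  obtain d where d: "g d = e" using surj by (metis surjD)
  have e: "x = y" if "mat x ** e = mat y ** e" for x y
    using arg_cong[OF that, of "\<lambda>a. a $ 1 $ 1"] by (simp, simp add: e_def)
  have mat_add: "mat (x + y) = mat x + (mat y :: real quat^1^1)" for x y
    by (simp add: vec_eq_iff mat_def)
  have "\<theta> (x + y) = \<theta> x + \<theta> y" for x y
    by (rule e) (metis \<theta> d add mat_add matrix_add_rdistrib)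
  moreover have "\<theta> (x * y) = \<theta> x * \<theta> y" for x y
    by (rule e) (metis \<theta> d mat_mult_mat matrix_mul_assoc)
  moreover have "\<theta> (qscal r) = qscal r" for r
    by (rule e) (metis \<theta> d hom mat_qscal_mult)
  ultimately obtain p where p: "p * qcnj p = 1" and \<theta>p: "\<And>x. \<theta> x * p = p * x"
    by (rule quat_endomorphism_inner[of \<theta>]) blast
  have p': "qcnj p * p = 1" using p by (simp add: quat_eq_iff)
  have cancel: "mat (qcnj p) ** (mat p ** a) = a" "mat p ** (mat (qcnj p) ** a) = a" for a :: "real quat^3^1"
    by (simp_all add: matrix_mul_assoc mat_mult_mat p p')
  have "mat (qcnj p) ** g (a + b) = mat (qcnj p) ** g a + mat (qcnj p) ** g b" for a b
    by (simp add: add matrix_add_ldistrib)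
  \<comment> \<open>Stripping \<open>p\<close> from \<open>g\<close> undoes the twist by \<theta>:
    what remains is left linear over the quaternions, hence right multiplication by a
    matrix.\<close>
  moreover have "mat (qcnj p) ** g (mat q ** a) = mat q ** (mat (qcnj p) ** g a)" for q a
  proof -
    have "qcnj p * \<theta> q = qcnj p * (\<theta> q * p) * qcnj p" by (simp add: mult.assoc p)
    also have "\<dots> = q * qcnj p" by (metis \<theta>p p' mult.assoc mult.left_neutral)
    finally show ?thesis by (simp add: \<theta> matrix_mul_assoc mat_mult_mat)
  qed
  ultimately obtain B where B: "\<And>a. mat (qcnj p) ** g a = a ** B"
    by (rule left_linear_row[of "\<lambda>a. mat (qcnj p) ** g a"]) blast
  have g: "g a = mat p ** a ** B" for a
    by (metis B cancel(2) matrix_mul_assoc)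
  define P :: "real quat^1^1" where "P = mat p"
  have P: "P \<in> carrier Sp" "qadj P ** P = mat 1"
  proof -
    have "qadj P = mat (qcnj p)" by (simp add: P_def vec_eq_iff qadj_def mat_def)
    then show "P \<in> carrier Sp" "qadj P ** P = mat 1" by (simp_all add: Sp_def P_def mat_mult_mat p p')
  qed
  \<comment> \<open>With \<open>P\<close> unitary, invariance of the inner product says that
    \<open>B ** qadj B\<close> acts on rows as the identity.\<close>
  have BB: "B ** qadj B = mat 1"
  proof (rule row_matrix_eqI, rule mtr_nondegenerate)
    fix a z :: "real quat^3^1"
    have "mtr (a ** qadj z) = mtr (P ** (a ** B ** qadj B ** qadj z) ** qadj P)"
      by (subst inner[symmetric]) (simp add: g P_def qadj_mult matrix_mul_assoc)
    then show "mtr (a ** (B ** qadj B) ** qadj z) = mtr (a ** mat 1 ** qadj z)"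
      unfolding mtr_conj[OF P(2)] by (simp add: matrix_mul_assoc)
  qed
  have A: "qadj B \<in> carrier Sp"
    using qadj_mult_self[OF BB] by (simp add: Sp_def)
  have "f M = qadj B ** M ** B" if M: "qadj M = M" for M
  proof -
    \<comment> \<open>The module law for \<open>g\<close>, after cancelling
      \<open>p\<close>.\<close>
    have "a ** (M ** B) = a ** (B ** f M)" for a :: "real quat^3^1"
      using module[OF M, of a] cancel(1) by (metis B matrix_mul_assoc)
    then have "M ** B = B ** f M" by (rule row_matrix_eqI)
    then show ?thesis by (metis qadj_mult_self[OF BB] matrix_mul_assoc matrix_mul_lid)
  qed
  then show thesis
    using that[OF P(1) A] g by (simp add: P_def)
qed

section \<open>The kernel and the image of the action\<close>

lemma minus_eq_self_quat_matrix: "- A = A \<longleftrightarrow> A = (0 :: complex quat^'n^'m)"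
  by (simp add: vec_eq_iff quat_eq_iff neg_equal_zero)

text \<open>A description through \<gamma> and \<tau> alone, so that any \<alpha> commuting with
  both respects this real form.\<close>

lemma real_quat_part:
  "Y \<in> JC \<and> gamma Y = Y \<and> tau Y = Y \<longleftrightarrow> (\<exists>N. qadj N = N \<and> Y = oct_matrix (mat_complex N) 0)"
proof (intro iffI; (elim conjE exE)?)
  assume "Y \<in> JC" "gamma Y = Y" "tau Y = Y"
  then obtain N b where Y: "Y = oct_matrix N b" "qadj N = N" "b = 0" "mat_cnj N = N"
    by (elim JC_cases) (auto simp: gamma_oct_matrix tau_oct_matrix minus_eq_self_quat_matrix)
  moreover obtain M where "N = mat_complex M" by (rule mat_cnj_fixed[OF Y(4)])
  ultimately show "\<exists>N. qadj N = N \<and> Y = oct_matrix (mat_complex N) 0"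
    by (metis mat_complex_simps(4,6))
next
  fix N assume N: "qadj N = N" "Y = oct_matrix (mat_complex N) 0"
  then have "qadj (mat_complex N) = mat_complex N" by (metis mat_complex_simps(4))
  then show "Y \<in> JC \<and> gamma Y = Y \<and> tau Y = Y" by (simp add: N(2) gamma_oct_matrix tau_oct_matrix)
qed

lemma quat_scale_minus_one [simp]: "quat_scale (- 1) A = - A"
  by (simp add: vec_eq_iff) (simp add: quat_eq_iff)

text \<open>The eigenvalue -1 of \<gamma> is written with \<open>cscale\<close>, which complex
  linearity moves past \<alpha>.\<close>

lemma real_row_part:
  "Y \<in> JC \<and> gamma Y = cscale (- 1) Y \<and> tau Y = Y \<longleftrightarrow> (\<exists>b. Y = oct_matrix 0 (mat_complex b))"
proof (intro iffI; (elim conjE exE)?)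
  assume "Y \<in> JC" "gamma Y = cscale (- 1) Y" "tau Y = Y"
  then obtain N b where Y: "Y = oct_matrix N b" "N = 0" "mat_cnj b = b"
    by (elim JC_cases)
      (auto simp: gamma_oct_matrix tau_oct_matrix cscale_oct_matrix minus_eq_self_quat_matrix eq_commute[of _ "- _"])
  moreover obtain c where "b = mat_complex c" by (rule mat_cnj_fixed[OF Y(3)])
  ultimately show "\<exists>b. Y = oct_matrix 0 (mat_complex b)" by blast
qed (simp add: gamma_oct_matrix tau_oct_matrix cscale_oct_matrix)

lemma complex_quat_matrix_cases:
  obtains B C where "A = mat_complex B + quat_scale \<i> (mat_complex C)"
proof
  show "A = mat_complex (map_matrix (map_quat Re) A) + quat_scale \<i> (mat_complex (map_matrix (map_quat Im) A))"
    by (simp add: vec_eq_iff mat_complex_nth quat_eq_iff quat.map_sel complex_eq_iff)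
qed

lemma mat_complex_add_ii_inject:
  "mat_complex B + quat_scale \<i> (mat_complex C) = mat_complex B' + quat_scale \<i> (mat_complex C') \<longleftrightarrow> B = B' \<and> C = C'"
  by (auto simp: vec_eq_iff mat_complex_nth quat_eq_iff quat.map_sel complex_eq_iff)

lemma qadj_mat_complex: "qadj M = M \<Longrightarrow> qadj (mat_complex M) = mat_complex M"
  by (metis mat_complex_simps(4))

text \<open>Real Hermitian matrices and real rows together span \<open>JC\<close> over the complex
  numbers.\<close>

lemma E6_oct_matrix_eqI:
  assumes "\<alpha> \<in> E6" "\<beta> \<in> E6"
    and M: "\<And>M. qadj M = M \<Longrightarrow> \<alpha> (oct_matrix (mat_complex M) 0) = \<beta> (oct_matrix (mat_complex M) 0)"
    and a: "\<And>a. \<alpha> (oct_matrix 0 (mat_complex a)) = \<beta> (oct_matrix 0 (mat_complex a))"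
  shows "\<alpha> = \<beta>"
proof (rule extensionalityI)
  show "\<alpha> \<in> extensional JC" "\<beta> \<in> extensional JC"
    using assms by (auto simp: E6_def Iso_C_def Bij_def)
  have lin: "f (X + Y) = f X + f Y" "f (cscale c X) = cscale c (f X)" if "f \<in> {\<alpha>, \<beta>}" "X \<in> JC" "Y \<in> JC" for f c X Y
    using assms that by (auto simp: E6_def Iso_C_def)
  have real: "\<alpha> (oct_matrix (mat_complex M) (mat_complex a)) = \<beta> (oct_matrix (mat_complex M) (mat_complex a))" if "qadj M = M" for M a
  proof -
    have "oct_matrix (mat_complex M) (mat_complex a) = oct_matrix (mat_complex M) 0 + oct_matrix 0 (mat_complex a)" by (simp add: oct_matrix_add)
    then show ?thesis using that by (simp add: lin qadj_mat_complex M a)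
  qed
  fix X assume "X \<in> JC"
  then obtain N b where X: "X = oct_matrix N b" "qadj N = N" by (rule JC_cases)
  obtain B C where N: "N = mat_complex B + quat_scale \<i> (mat_complex C)" by (rule complex_quat_matrix_cases)
  \<comment> \<open>\<open>qadj\<close> leaves the complex unit alone, so it acts on the two real
    components separately.\<close>
  have "qadj B = B \<and> qadj C = C"
    using X(2) by (simp add: N mat_complex_add_ii_inject flip: mat_complex_simps(4))
  then have BC: "qadj B = B" "qadj C = C" by simp_all
  obtain c d where cd: "b = mat_complex c + quat_scale \<i> (mat_complex d)" by (rule complex_quat_matrix_cases)
  have "X = oct_matrix (mat_complex B) (mat_complex c) + cscale \<i> (oct_matrix (mat_complex C) (mat_complex d))"
    by (simp add: X N cd oct_matrix_add cscale_oct_matrix)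
  moreover have "oct_matrix (mat_complex B) (mat_complex c) \<in> JC" "oct_matrix (mat_complex C) (mat_complex d) \<in> JC" "cscale \<i> (oct_matrix (mat_complex C) (mat_complex d)) \<in> JC"
    by (simp_all add: cscale_oct_matrix BC qadj_mat_complex)
  ultimately show "\<alpha> X = \<beta> X"
    by (simp add: lin real BC)
qed

lemma mtr_mat_complex_row:
  fixes x :: "real quat^'n^'m"
  shows "mtr (mat_complex x ** qadj (mat_complex y)) = complex_of_real (mtr (x ** qadj y))"
    "mtr (mat_complex x ** mat_complex M ** qadj (mat_complex y)) = complex_of_real (mtr (x ** M ** qadj y))"
  by (metis mat_complex_mult mat_complex_simps(4) mtr_mat_complex)+

lemma Int_eq_phi:
  assumes \<alpha>: "\<alpha> \<in> E6_lambda_gamma \<inter> E6_gamma"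
  obtains P A where "P \<in> carrier Sp" "A \<in> carrier Sp" "\<alpha> = phi (P, A)"
proof -
  have E6: "\<alpha> \<in> E6" and g0: "\<And>X. X \<in> JC \<Longrightarrow> gamma (\<alpha> (gamma X)) = \<alpha> X"
    and t0: "\<And>X. X \<in> JC \<Longrightarrow> tau (\<alpha> (tau X)) = \<alpha> X"
    using \<alpha> unfolding mem_E6_lambda_gamma_Int_iff by auto
  have bij: "bij_betw \<alpha> JC JC" and add: "\<And>X Y. X \<in> JC \<Longrightarrow> Y \<in> JC \<Longrightarrow> \<alpha> (X + Y) = \<alpha> X + \<alpha> Y"
    and scale: "\<And>c X. X \<in> JC \<Longrightarrow> \<alpha> (cscale c X) = cscale c (\<alpha> X)"
    and det: "\<And>X. X \<in> JC \<Longrightarrow> jdet (\<alpha> X) = jdet X"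
    and herm: "\<And>X Y. X \<in> JC \<Longrightarrow> Y \<in> JC \<Longrightarrow> jherm (\<alpha> X) (\<alpha> Y) = jherm X Y"
    using E6 by (auto simp: E6_def Iso_C_def Bij_def)
  have in_JC: "\<alpha> X \<in> JC" if "X \<in> JC" for X using bij that by (auto simp: bij_betw_def)
  have inj: "\<alpha> X = \<alpha> Y \<longleftrightarrow> X = Y" if "X \<in> JC" "Y \<in> JC" for X Y
    using bij that by (auto simp: bij_betw_def inj_on_def)
  have sc: "cscale c X \<in> JC" if "X \<in> JC" for c X
    using that by (elim JC_cases) (simp add: cscale_oct_matrix)
  have "gamma (gamma X) = X" if "X \<in> JC" for X
    using that by (elim JC_cases) (simp add: gamma_oct_matrix)
  then have g: "gamma (\<alpha> X) = \<alpha> (gamma X)" if "X \<in> JC" for X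
    using g0[OF that] that by (metis in_JC gamma_in_JC)
  have t: "tau (\<alpha> X) = \<alpha> (tau X)" if "X \<in> JC" for X
    using t0[OF that] by (metis tau_tau)
  \<comment> \<open>Both directions are used: one yields \<open>f\<close>, the other its
    surjectivity. The same holds for \<open>row\<close> and \<open>h\<close>.\<close>
  have quat: "(\<exists>N. qadj N = N \<and> \<alpha> X = oct_matrix (mat_complex N) 0) \<longleftrightarrow> (\<exists>N. qadj N = N \<and> X = oct_matrix (mat_complex N) 0)"
    if X: "X \<in> JC" for X
    unfolding real_quat_part[symmetric] using X
    by (simp add: g t inj gamma_in_JC tau_in_JC in_JC)
  have row: "(\<exists>b. \<alpha> X = oct_matrix 0 (mat_complex b)) \<longleftrightarrow> (\<exists>b. X = oct_matrix 0 (mat_complex b))"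
    if X: "X \<in> JC" for X
    unfolding real_row_part[symmetric] using X
    by (simp add: g t inj gamma_in_JC tau_in_JC in_JC sc flip: scale)
  have "\<exists>N. qadj M = M \<longrightarrow> qadj N = N \<and> \<alpha> (oct_matrix (mat_complex M) 0) = oct_matrix (mat_complex N) 0" for M
    using quat[of "oct_matrix (mat_complex M) 0"] qadj_mat_complex[of M] by (metis oct_matrix_in_JC_iff)
  then obtain f where f: "\<And>M. qadj M = M \<Longrightarrow> qadj (f M) = f M"
    "\<And>M. qadj M = M \<Longrightarrow> \<alpha> (oct_matrix (mat_complex M) 0) = oct_matrix (mat_complex (f M)) 0" by metis
  have z: "oct_matrix 0 a \<in> JC" for a :: "complex quat^3^1" by simp
  have "\<exists>b. \<alpha> (oct_matrix 0 (mat_complex a)) = oct_matrix 0 (mat_complex b)" for a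
    using row[OF z, of "mat_complex a"] by blast
  then obtain h where h: "\<And>a. \<alpha> (oct_matrix 0 (mat_complex a)) = oct_matrix 0 (mat_complex (h a))" by metis
  have fsurj: "\<exists>M. qadj M = M \<and> f M = N" if N: "qadj N = N" for N
  proof -
    have "oct_matrix (mat_complex N) 0 \<in> \<alpha> ` JC"
      using bij_betw_imp_surj_on[OF bij] qadj_mat_complex[OF N] by simp
    then obtain X where X: "X \<in> JC" "\<alpha> X = oct_matrix (mat_complex N) 0" by auto
    then obtain M where "qadj M = M" "X = oct_matrix (mat_complex M) 0" using quat[OF X(1)] N by blast
    then show ?thesis using f(2)[of M] X(2) by auto
  qed
  have hsurj: "surj h"
    unfolding surj_def
  proof
    fix b
    have "oct_matrix 0 (mat_complex b) \<in> \<alpha> ` JC"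
      using bij_betw_imp_surj_on[OF bij] by simp
    then obtain X where X: "X \<in> JC" "\<alpha> X = oct_matrix 0 (mat_complex b)" by auto
    then obtain a where "X = oct_matrix 0 (mat_complex a)" using row[OF X(1)] by blast
    then show "\<exists>a. b = h a" using h[of a] X(2) by auto
  qed
  have hadd: "h (a + b) = h a + h b" for a b
    using add[OF z z, of "mat_complex a" "mat_complex b"] by (simp add: oct_matrix_add h flip: mat_complex_simps(1))
  have hhom: "h (quat_scale r a) = quat_scale r (h a)" for r a
    using scale[OF z, of "complex_of_real r" "mat_complex a"] by (simp add: cscale_oct_matrix h flip: mat_complex_simps(5))
  have hinner: "mtr (h a ** qadj (h b)) = mtr (a ** qadj b)" for a b
    using herm[OF z z, of "mat_complex a" "mat_complex b"] by (simp add: jherm_def tau_oct_matrix jinner_oct_matrix h mtr_mat_complex_row mtr_simps matrix_minus_simps)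
  have tri: "mtr (h a ** f M ** qadj (h a)) = mtr (a ** M ** qadj a)" if M: "qadj M = M" for a M
  proof -
    have M': "oct_matrix (mat_complex M) 0 \<in> JC" using qadj_mat_complex[OF M] by simp
    have "oct_matrix (mat_complex M) (mat_complex a) = oct_matrix (mat_complex M) 0 + oct_matrix 0 (mat_complex a)" by (simp add: oct_matrix_add)
    then have "\<alpha> (oct_matrix (mat_complex M) (mat_complex a)) = oct_matrix (mat_complex (f M)) (mat_complex (h a))"
      using add[OF M' z] by (simp add: f(2)[OF M] h oct_matrix_add)
    then have "jdet (oct_matrix (mat_complex (f M)) (mat_complex (h a))) = jdet (oct_matrix (mat_complex M) (mat_complex a))"
      using det[of "oct_matrix (mat_complex M) (mat_complex a)"] qadj_mat_complex[OF M] by simp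
    \<comment> \<open>Comparing with the determinant at \<open>a = 0\<close> removes
      \<open>qdet\<close> and isolates the trilinear term.\<close>
    moreover have "jdet (oct_matrix (mat_complex (f M)) 0) = jdet (oct_matrix (mat_complex M) 0)"
      using det[OF M'] by (simp add: f(2)[OF M])
    ultimately show ?thesis
      by (simp add: jdet_oct_matrix qadj_mat_complex M f(1) mtr_mat_complex_row matrix_minus_simps mtr_simps)
  qed
  obtain P A where PA: "P \<in> carrier Sp" "A \<in> carrier Sp" "\<And>a. h a = P ** a ** qadj A"
    "\<And>M. qadj M = M \<Longrightarrow> f M = A ** M ** qadj A"
    using Sp_pair_of_invariant[OF hadd hhom hinner hsurj f(1) fsurj tri] by metis
  have "\<alpha> = phi (P, A)"
    by (rule E6_oct_matrix_eqI[OF E6 phi_in_E6[OF PA(1,2)]])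
      (simp_all add: f(2) h phi_oct_matrix PA(3,4) qadj_mat_complex matrix_minus_simps)
  then show thesis using that PA(1,2) by blast
qed

text \<open>Triviality on rows means \<open>P ** a = a ** A\<close>. Rows of zeros and ones force
  \<open>A\<close> to be the scalar matrix of the quaternion \<open>p\<close> in \<open>P\<close>;
  constant rows then show that \<open>p\<close> is central, so it is real of norm 1.\<close>

lemma phi_eq_id:
  assumes P: "P \<in> carrier Sp" and A: "A \<in> carrier Sp" and id: "\<And>X. X \<in> JC \<Longrightarrow> phi (P, A) X = X"
  shows "(P, A) \<in> Z2"
proof -
  have eq: "P ** a = a ** A" for a :: "real quat^3^1"
  proof -
    have "mat_complex (P ** a ** qadj A) = mat_complex a"
      using id[of "oct_matrix 0 (mat_complex a)"] by (simp add: phi_oct_matrix matrix_minus_simps)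
    then have "P ** a ** qadj A = a" by (simp only: mat_complex_simps)
    then show ?thesis by (metis mult_qadj_cancel(2)[OF Sp_D(2)[OF A]])
  qed
  define p where "p = P $ 1 $ 1"
  have Pp: "P = mat p" by (simp add: p_def vec_eq_iff mat_def forall_1)
  have Ap: "A = mat p"
  proof -
    \<comment> \<open>The entries 0 and 1 commute with \<open>p\<close>, and such rows include the
      standard basis, which determines \<open>A\<close>.\<close>
    have "(mat p ** a) = a ** mat p" if "\<And>i. a $ 1 $ i = 0 \<or> a $ 1 $ i = 1" for a :: "real quat^3^1"
      using that by (simp add: vec_eq_iff forall_1) (simp add: matrix_matrix_mult_def mat_def sum_3 forall_3, metis mult_zero_left mult_zero_right mult_1 mult.right_neutral)
    then have *: "a ** A = a ** mat p" if "\<And>i. a $ 1 $ i = 0 \<or> a $ 1 $ i = 1" for a :: "real quat^3^1"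
      using that eq[of a] Pp by metis
    have "A $ i $ j = (mat p :: real quat^3^3) $ i $ j" for i j
      using arg_cong[OF *[of "\<chi> k l. if l = i then 1 else 0"], of "\<lambda>a. a $ 1 $ j"]
      by (simp add: matrix_matrix_mult_def if_distrib[of "\<lambda>x. x * _"] sum.delta cong: if_cong)
    then show ?thesis by (simp add: vec_eq_iff)
  qed
  have comm: "p * x = x * p" for x
    using arg_cong[OF eq[of "\<chi> i j. x"], of "\<lambda>a. a $ 1 $ 1"]
    by (simp add: Pp) (simp add: Ap matrix_matrix_mult_def mat_def sum_3)
  have "qi p = 0" "qj p = 0" "qk p = 0"
    using comm[of "Quat 0 1 0 0"] comm[of "Quat 0 0 1 0"] by (simp_all add: quat_eq_iff)
  moreover have "p * qcnj p = 1"
    using arg_cong[OF Sp_D(1)[OF P], of "\<lambda>a. a $ 1 $ 1"]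
    by (simp add: Pp) (simp add: qadj_def mat_def)
  ultimately have "p = 1 \<or> p = - 1"
    by (simp add: quat_eq_iff square_eq_1_iff)
  moreover have "mat (- 1) = (- mat 1 :: real quat^1^1)" "mat (- 1) = (- mat 1 :: real quat^3^3)"
    by (simp_all add: vec_eq_iff mat_def)
  ultimately show ?thesis by (auto simp: Z2_def Pp Ap)
qed

section \<open>The homomorphism, its kernel and the algebraic isomorphism\<close>

lemma phi_extensional: "phi x \<in> extensional JC"
  by (cases x) (simp add: phi_def)

lemma phi_minus_one: "X \<in> JC \<Longrightarrow> phi (- mat 1, - mat 1) X = X"
  by (erule JC_cases) (simp add: phi_oct_matrix matrix_minus_simps)

abbreviation "SpSp \<equiv> (Sp :: (real quat^1^1) monoid) \<times>\<times> (Sp :: (real quat^3^3) monoid)"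
abbreviation "E6_Int \<equiv> BijGroup JC\<lparr>carrier := E6_lambda_gamma \<inter> E6_gamma\<rparr>"

lemma phi_image: "phi ` carrier SpSp = E6_lambda_gamma \<inter> E6_gamma"
proof
  show "phi ` carrier SpSp \<subseteq> E6_lambda_gamma \<inter> E6_gamma"
    by (rule image_subsetI, simp only: carrier_DirProd, elim SigmaE, simp only: phi_in_Int)
  show "E6_lambda_gamma \<inter> E6_gamma \<subseteq> phi ` carrier SpSp"
  proof
    fix \<alpha> assume "\<alpha> \<in> E6_lambda_gamma \<inter> E6_gamma"
    then obtain P A where "P \<in> carrier Sp" "A \<in> carrier Sp" "\<alpha> = phi (P, A)" by (rule Int_eq_phi)
    then show "\<alpha> \<in> phi ` carrier SpSp" by (auto simp: DirProd_def)
  qed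
qed

lemma phi_group_hom_Bij: "group_hom SpSp (BijGroup JC) phi"
proof -
  have "phi \<in> hom SpSp (BijGroup JC)"
  proof (rule homI)
    fix x y assume "x \<in> carrier SpSp" "y \<in> carrier SpSp"
    moreover obtain P A Q B where xy: "x = (P, A)" "y = (Q, B)" by (cases x, cases y)
    ultimately have S: "P \<in> carrier Sp" "A \<in> carrier Sp" "Q \<in> carrier Sp" "B \<in> carrier Sp"
      by (auto simp: DirProd_def)
    have "phi (P ** Q, A ** B) = compose JC (phi (P, A)) (phi (Q, B))"
      by (rule extensionalityI[of _ JC]) (auto simp: phi_extensional compose_eq phi_phi)
    then show "phi (x \<otimes>\<^bsub>SpSp\<^esub> y) = phi x \<otimes>\<^bsub>BijGroup JC\<^esub> phi y"
      using S by (simp add: xy BijGroup_def phi_Bij DirProd_def) (simp add: Sp_def)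
  qed (auto simp: DirProd_def BijGroup_def phi_Bij)
  then show ?thesis
    by (simp add: group_hom_def group_hom_axioms_def DirProd_group Sp_group group_BijGroup)
qed

text \<open>That the intersection is a group is read off from its being the image of
  \<open>phi\<close> in \<open>BijGroup JC\<close>.\<close>

lemma phi_group_hom: "group_hom SpSp E6_Int phi"
proof -
  interpret group_hom SpSp "BijGroup JC" phi by (rule phi_group_hom_Bij)
  have "subgroup (E6_lambda_gamma \<inter> E6_gamma) (BijGroup JC)"
    using img_is_subgroup by (simp only: phi_image)
  then have "group E6_Int" by (rule H.subgroup_imp_group)
  moreover have "phi \<in> hom SpSp E6_Int"
    using homh phi_image by (auto simp: hom_def)
  ultimately show ?thesis
    by (simp add: group_hom_def group_hom_axioms_def G.is_group)
qed

lemma phi_kernel: "kernel SpSp E6_Int phi = Z2"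
proof -
  have "phi x = (\<lambda>X\<in>JC. X) \<longleftrightarrow> x \<in> Z2" if "x \<in> carrier SpSp" for x
  proof
    assume *: "phi x = (\<lambda>X\<in>JC. X)"
    obtain P A where x: "x = (P, A)" by (cases x)
    show "x \<in> Z2" unfolding x
      by (rule phi_eq_id) (use that * x in \<open>auto simp: DirProd_def\<close>)
  next
    assume "x \<in> Z2"
    then show "phi x = (\<lambda>X\<in>JC. X)"
      by (intro extensionalityI[of _ JC])
        (auto simp: Z2_def phi_one phi_minus_one phi_extensional)
  qed
  moreover have "Z2 \<subseteq> carrier SpSp"
    by (auto simp: Z2_def DirProd_def Sp_def matrix_minus_simps)
  ultimately show ?thesis by (auto simp: kernel_def BijGroup_def)
qed

lemma phi_factor_iso: "(\<lambda>X. the_elem (phi ` X)) \<in> iso (SpSp Mod Z2) E6_Int"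
proof -
  have "phi ` carrier SpSp = carrier E6_Int" by (simp add: phi_image del: carrier_DirProd)
  then show ?thesis
    using group_hom.FactGroup_iso_set[OF phi_group_hom] by (simp only: phi_kernel)
qed

section \<open>Topology\<close>

text \<open>Open sets are defined by preimages under \<open>Quat\<close>, so a map out of the
  quaternions is continuous once its composite with the constructor is.\<close>

lemma continuous_on_quat_sel [continuous_intros]:
  fixes f :: "'b::topological_space \<Rightarrow> 'a::topological_space quat"
  assumes "continuous_on S f"
  shows "continuous_on S (\<lambda>x. qre (f x))" "continuous_on S (\<lambda>x. qi (f x))"
    "continuous_on S (\<lambda>x. qj (f x))" "continuous_on S (\<lambda>x. qk (f x))"
proof -
  have *: "continuous_on S (\<lambda>x. p (f x))"
    if "continuous_on UNIV (\<lambda>(a, b, c, d). p (Quat a b c d))" for p :: "'a quat \<Rightarrow> 'a"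
  proof -
    have "open (p -` U)" if "open U" for U
      using open_vimage[OF that \<open>continuous_on UNIV _\<close>] 
      by (simp add: open_quat_def vimage_def case_prod_beta)
    then have "continuous_on UNIV p" by (simp add: continuous_on_open_vimage)
    then show ?thesis using assms by (rule continuous_on_compose2) simp
  qed
  show "continuous_on S (\<lambda>x. qre (f x))" "continuous_on S (\<lambda>x. qi (f x))"
    "continuous_on S (\<lambda>x. qj (f x))" "continuous_on S (\<lambda>x. qk (f x))"
    by (rule *; simp add: case_prod_beta continuous_intros)+
qed

lemma continuous_on_Quat [continuous_intros]:
  fixes f g h k :: "'b::topological_space \<Rightarrow> 'a::topological_space"
  assumes "continuous_on S f" "continuous_on S g" "continuous_on S h" "continuous_on S k"
  shows "continuous_on S (\<lambda>x. Quat (f x) (g x) (h x) (k x))"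
proof -
  have "continuous_on UNIV (\<lambda>(a :: 'a, b, c, d). Quat a b c d)"
    by (simp add: continuous_on_open_vimage open_quat_def)
  then have "continuous_on S ((\<lambda>(a, b, c, d). Quat a b c d) \<circ> (\<lambda>x. (f x, g x, h x, k x)))"
    by (intro continuous_on_compose continuous_intros assms) (auto intro: continuous_on_subset)
  then show ?thesis by (simp add: o_def)
qed

lemma continuous_on_Oct [continuous_intros]:
  fixes f g :: "'b::topological_space \<Rightarrow> 'a::topological_space quat"
  assumes "continuous_on S f" "continuous_on S g"
  shows "continuous_on S (\<lambda>x. Oct (f x) (g x))"
proof -
  have "continuous_on UNIV (\<lambda>(a :: 'a quat, b). Oct a b)"
    by (simp add: continuous_on_open_vimage open_oct_def)
  then have "continuous_on S ((\<lambda>(a, b). Oct a b) \<circ> (\<lambda>x. (f x, g x)))"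
    by (intro continuous_on_compose continuous_intros assms) (auto intro: continuous_on_subset)
  then show ?thesis by (simp add: o_def)
qed

lemma continuous_on_oct_sel [continuous_intros]:
  fixes f :: "'b::topological_space \<Rightarrow> 'a::topological_space oct"
  assumes "continuous_on S f"
  shows "continuous_on S (\<lambda>x. hpart (f x))" "continuous_on S (\<lambda>x. epart (f x))"
proof -
  have *: "continuous_on S (\<lambda>x. p (f x))"
    if "continuous_on UNIV (\<lambda>(a, b). p (Oct a b))" for p :: "'a oct \<Rightarrow> 'a quat"
  proof -
    have "open (p -` U)" if "open U" for U
      using open_vimage[OF that \<open>continuous_on UNIV _\<close>] 
      by (simp add: open_oct_def vimage_def case_prod_beta)
    then have "continuous_on UNIV p" by (simp add: continuous_on_open_vimage)
    then show ?thesis using assms by (rule continuous_on_compose2) simp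
  qed
  show "continuous_on S (\<lambda>x. hpart (f x))" "continuous_on S (\<lambda>x. epart (f x))"
    by (rule *; simp add: case_prod_beta continuous_intros)+
qed

section \<open>The Hausdorff property, from continuous coordinates that separate points\<close>

lemma t2_space_if_separating:
  fixes x y :: "'a::topological_space"
  assumes "continuous_on UNIV f" "f x \<noteq> (f y :: 'b::t2_space)"
  shows "\<exists>U V. open U \<and> open V \<and> x \<in> U \<and> y \<in> V \<and> U \<inter> V = {}"
proof -
  obtain U V where "open U" "open V" "f x \<in> U" "f y \<in> V" "U \<inter> V = {}"
    using hausdorff[OF assms(2)] by blast
  then show ?thesis
    using assms(1) by (intro exI[of _ "f -` U"] exI[of _ "f -` V"]) (auto simp: open_vimage)
qed

instance quat :: (t2_space) t2_space
proof
  fix x y :: "'a quat"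
  assume "x \<noteq> y"
  then consider "qre x \<noteq> qre y" | "qi x \<noteq> qi y" | "qj x \<noteq> qj y" | "qk x \<noteq> qk y"
    by (auto simp: quat_eq_iff)
  then show "\<exists>U V. open U \<and> open V \<and> x \<in> U \<and> y \<in> V \<and> U \<inter> V = {}"
    by cases (erule t2_space_if_separating[rotated], intro continuous_intros)+
qed

instance oct :: (t2_space) t2_space
proof
  fix x y :: "'a oct"
  assume "x \<noteq> y"
  then consider "hpart x \<noteq> hpart y" | "epart x \<noteq> epart y"
    by (auto simp: oct_eq_iff)
  then show "\<exists>U V. open U \<and> open V \<and> x \<in> U \<and> y \<in> V \<and> U \<inter> V = {}"
    by cases (erule t2_space_if_separating[rotated], intro continuous_intros)+
qed

lemma Hausdorff_space_euclidean_matrix: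
  "Hausdorff_space (euclidean :: ('a::t2_space^'n^'m) topology)"
  unfolding Hausdorff_space_def
proof (intro allI impI)
  fix x y :: "'a^'n^'m"
  assume "x \<in> topspace euclidean \<and> y \<in> topspace euclidean \<and> x \<noteq> y"
  then obtain i j where "x $ i $ j \<noteq> y $ i $ j" by (auto simp: vec_eq_iff)
  then have "\<exists>U V. open U \<and> open V \<and> x \<in> U \<and> y \<in> V \<and> U \<inter> V = {}"
    by (rule t2_space_if_separating[rotated]) (intro continuous_on_component continuous_on_id)
  then show "\<exists>U V. openin euclidean U \<and> openin euclidean V \<and> x \<in> U \<and> y \<in> V \<and> disjnt U V"
    by (simp add: disjnt_def)
qed

section \<open>Continuity of the matrix operations\<close>

lemma continuous_on_quat_plus [continuous_intros]:
  fixes f g :: "'b::topological_space \<Rightarrow> 'a::{topological_ab_group_add} quat"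
  assumes "continuous_on S f" "continuous_on S g"
  shows "continuous_on S (\<lambda>x. f x + g x)"
  unfolding plus_quat_def by (intro continuous_intros assms)

lemma continuous_on_quat_times [continuous_intros]:
  fixes f g :: "'b::topological_space \<Rightarrow> 'a::{real_normed_field} quat"
  assumes "continuous_on S f" "continuous_on S g"
  shows "continuous_on S (\<lambda>x. f x * g x)"
  unfolding times_quat_def by (intro continuous_intros assms)

lemma continuous_on_quat_sum:
  fixes f :: "'c \<Rightarrow> 'b::topological_space \<Rightarrow> 'a::{topological_ab_group_add} quat"
  assumes "\<And>i. continuous_on S (f i)"
  shows "continuous_on S (\<lambda>x. \<Sum>i\<in>I. f i x)"
  by (induction I rule: infinite_finite_induct) (simp_all add: assms continuous_intros)

lemma continuous_on_quat_matrix_mult [continuous_intros]: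
  fixes f :: "'b::topological_space \<Rightarrow> 'a::{real_normed_field} quat^'n^'m"
  assumes "continuous_on S f" "continuous_on S g"
  shows "continuous_on S (\<lambda>x. f x ** g x)"
  unfolding matrix_matrix_mult_def
  by (intro continuous_intros continuous_on_quat_sum continuous_on_component assms)

lemma continuous_on_qadj [continuous_intros]:
  fixes f :: "'b::topological_space \<Rightarrow> 'a::{topological_ab_group_add} quat^'n^'m"
  assumes "continuous_on S f"
  shows "continuous_on S (\<lambda>x. qadj (f x))"
  unfolding qadj_def qcnj_def by (intro continuous_intros continuous_on_component assms)

lemma continuous_on_mat_complex [continuous_intros]:
  fixes f :: "'b::topological_space \<Rightarrow> real quat^'n^'m"
  assumes "continuous_on S f"
  shows "continuous_on S (\<lambda>x. mat_complex (f x))"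
proof -
  have "mat_complex A = (\<chi> i j. Quat (complex_of_real (qre (A $ i $ j))) (complex_of_real (qi (A $ i $ j)))
     (complex_of_real (qj (A $ i $ j))) (complex_of_real (qk (A $ i $ j))))" for A :: "real quat^'n^'m"
    by (simp add: vec_eq_iff mat_complex_nth quat_eq_iff quat.map_sel)
  then show ?thesis by (simp only:) (intro continuous_intros continuous_on_component assms)
qed

lemma continuous_on_oct_matrix [continuous_intros]:
  fixes f :: "'b::topological_space \<Rightarrow> 'a::{topological_ab_group_add} quat^3^3"
  assumes "continuous_on S f" "continuous_on S g"
  shows "continuous_on S (\<lambda>x. oct_matrix (f x) (g x))"
proof -
  have neg: "continuous_on S (\<lambda>x. - h x)" if "continuous_on S h" for h :: "'b \<Rightarrow> 'a quat"
    unfolding uminus_quat_def by (intro continuous_intros that)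
  have "\<forall>i j. continuous_on S (\<lambda>x. skew (g x) $ i $ j)"
    by (simp add: forall_3) (intro conjI continuous_intros neg continuous_on_component assms)
  then show ?thesis
    unfolding oct_matrix_def
    by (intro continuous_on_vec_lambda continuous_on_Oct continuous_on_component[of _ "\<lambda>x. f x $ _"])
      (auto intro: continuous_on_component assms)
qed

text \<open>Heine-Borel is applied in the Euclidean space of real coordinates, and compactness is
  carried over by the continuous map \<open>D\<close>.\<close>

lemma compact_Sp: "compact (carrier (Sp :: (real quat^'n^'n) monoid))"
proof -
  define D :: "real^4^'n^'n \<Rightarrow> real quat^'n^'n"
    where "D v = (\<chi> i j. Quat (v$i$j$1) (v$i$j$2) (v$i$j$3) (v$i$j$4))" for v
  define K where "K = {v. D v ** qadj (D v) = mat 1}"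
  have D: "continuous_on UNIV D"
    unfolding D_def by (intro continuous_intros continuous_on_component)
  have "closed K"
    unfolding K_def vec_eq_iff[where 'b = 'n]
    by (intro closed_Collect_all closed_Collect_eq continuous_intros D)
  moreover have "bounded K"
  proof (rule boundedI)
    fix v assume v: "v \<in> K"
    \<comment> \<open>The Euclidean norm is the trace norm, which is constant on the group.\<close>
    have "(norm v)\<^sup>2 = mtr (D v ** qadj (D v))"
      unfolding power2_norm_eq_inner mtr_adj_self
      by (simp add: inner_vec_def D_def sum_4 power2_eq_square)
    also have "\<dots> = real CARD('n)" using v by (simp add: K_def mtr_def mat_def)
    finally show "norm v \<le> sqrt (real CARD('n))" by (simp add: real_le_rsqrt)
  qed
  ultimately have "compact (D ` K)"
    by (meson D compact_continuous_image compact_eq_bounded_closed continuous_on_subset subset_UNIV)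
  moreover have "D ` K = carrier Sp"
  proof
    show "carrier Sp \<subseteq> D ` K"
    proof
      fix A :: "real quat^'n^'n" assume "A \<in> carrier Sp"
      moreover have "A = D (\<chi> i j k. if k = 1 then qre (A$i$j) else if k = 2 then qi (A$i$j)
          else if k = 3 then qj (A$i$j) else qk (A$i$j))"
        by (simp add: D_def vec_eq_iff quat_eq_iff)
      ultimately show "A \<in> D ` K" by (auto simp: Sp_def K_def)
    qed
  qed (auto simp: Sp_def K_def)
  ultimately show ?thesis by simp
qed

text \<open>For pointwise convergence it is enough to fix \<open>X\<close>; then \<open>phi\<close>
  is polynomial in the entries of the pair.\<close>

lemma phi_continuous:
  "continuous_map (prod_topology (top_of_set (carrier Sp)) (top_of_set (carrier Sp)))
    (subtopology JC_map_topology (E6_lambda_gamma \<inter> E6_gamma)) phi"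
  unfolding JC_map_topology_def
proof (intro continuous_map_into_subtopology continuous_map_componentwise[THEN iffD2] conjI ballI)
  fix X assume X: "X \<in> JC"
  have "continuous_on (carrier Sp \<times> carrier Sp) (\<lambda>PA. phi PA X)"
    unfolding phi_def case_prod_beta using X
    by simp (intro continuous_intros)
  then show "continuous_map (prod_topology (top_of_set (carrier Sp)) (top_of_set (carrier Sp))) euclidean (\<lambda>PA. phi PA X)"
    by (simp flip: subtopology_Times)
next
  show "phi ` topspace (prod_topology (top_of_set (carrier Sp)) (top_of_set (carrier Sp))) \<subseteq> extensional JC"
    by (auto simp: phi_extensional)
  show "phi \<in> topspace (prod_topology (top_of_set (carrier Sp)) (top_of_set (carrier Sp))) \<rightarrow> E6_lambda_gamma \<inter> E6_gamma"
    using phi_in_Int by (auto simp only: topspace_prod_topology topspace_euclidean_subtopology)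
qed

theorem theorem4p7p2:
  shows "topological_group_isomorphic
    (BijGroup JC\<lparr>carrier := E6_lambda_gamma \<inter> E6_gamma\<rparr>)
    (subtopology JC_map_topology (E6_lambda_gamma \<inter> E6_gamma))
    (((Sp :: (real quat^1^1) monoid) \<times>\<times> (Sp :: (real quat^3^3) monoid)) Mod Z2)
    (quotient_topology
      ((Sp :: (real quat^1^1) monoid) \<times>\<times> (Sp :: (real quat^3^3) monoid))
      (prod_topology (top_of_set (carrier Sp)) (top_of_set (carrier Sp)))
      Z2)"
proof -
  let ?T = "prod_topology (top_of_set (carrier (Sp :: (real quat^1^1) monoid)))
    (top_of_set (carrier (Sp :: (real quat^3^3) monoid)))"
  let ?E = "subtopology JC_map_topology (E6_lambda_gamma \<inter> E6_gamma)"
  let ?Q = "quotient_topology SpSp ?T Z2"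
  let ?\<psi> = "\<lambda>X. the_elem (phi ` X)"
  interpret group_hom SpSp E6_Int phi by (rule phi_group_hom)
  have T: "topspace ?T = carrier SpSp" by (simp add: DirProd_def)
  have sub: "E6_lambda_gamma \<inter> E6_gamma \<subseteq> topspace JC_map_topology"
    unfolding phi_image[symmetric] by (auto simp: JC_map_topology_def phi_extensional PiE_UNIV_domain PiE_def)
  \<comment> \<open>A continuous surjection from a compact space onto a Hausdorff space is a
    quotient map.\<close>
  have "quotient_map ?T ?E phi"
  proof (rule T1_Spaces.continuous_imp_quotient_map)
    show "continuous_map ?T ?E phi" by (rule phi_continuous)
    show "compact_space ?T"
      by (simp add: compact_space_subtopology compact_Sp compact_Times)
    show "Hausdorff_space ?E"
      by (simp add: JC_map_topology_def Hausdorff_space_subtopology Hausdorff_space_product_topology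
          Hausdorff_space_euclidean_matrix)
    show "phi ` topspace ?T = topspace ?E"
      using sub by (simp only: T phi_image topspace_subtopology) blast
  qed
  moreover have "phi x = (?\<psi> \<circ> (\<lambda>x. Z2 #>\<^bsub>SpSp\<^esub> x)) x" if "x \<in> topspace ?T" for x
  proof -
    have x: "x \<in> carrier SpSp" using that T by simp
    \<comment> \<open>\<open>phi\<close> is constant on cosets of its kernel, so
      \<open>the_elem\<close> picks out that common value.\<close>
    have "phi ` (Z2 #>\<^bsub>SpSp\<^esub> x) = {phi x}"
    proof -
      have "phi (z \<otimes>\<^bsub>SpSp\<^esub> x) = phi x" if "z \<in> Z2" for z
      proof -
        have "z \<in> carrier SpSp" "phi z = \<one>\<^bsub>E6_Int\<^esub>"
          using that by (auto simp: kernel_def simp del: carrier_DirProd simp flip: phi_kernel)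
        then show ?thesis using x hom_mult[of z x] H.l_one[OF hom_closed[OF x]] by metis
      qed
      then have "(\<lambda>z. phi (z \<otimes>\<^bsub>SpSp\<^esub> x)) ` Z2 = {phi x}"
        by (simp add: Z2_def)
      then show ?thesis by (simp add: r_coset_def image_UN UNION_singleton_eq_range image_image)
    qed
    then show ?thesis by simp
  qed
  ultimately have "quotient_map ?T ?E (?\<psi> \<circ> (\<lambda>x. Z2 #>\<^bsub>SpSp\<^esub> x))"
    by (rule quotient_map_eq)
  \<comment> \<open>The coset projection is itself a quotient map and can be cancelled from the
    composite.\<close>
  then have q: "quotient_map ?Q ?E ?\<psi>"
    using quotient_map_compose_eq[OF quotient_map_quotient_topology[OF T]] by blast
  have Q: "topspace ?Q = carrier (SpSp Mod Z2)"
    using quotient_imp_surjective_map[OF quotient_map_quotient_topology[OF T], of Z2]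
    by (auto simp: T carrier_FactGroup)
  have inj: "inj_on ?\<psi> (carrier (SpSp Mod Z2))"
    using phi_factor_iso by (simp add: iso_def bij_betw_def)
  \<comment> \<open>An injective quotient map is a homeomorphism.\<close>
  then have "homeomorphic_map ?Q ?E ?\<psi>"
    using q unfolding homeomorphic_map_def Q by blast
  then obtain k where k: "homeomorphic_maps ?Q ?E ?\<psi> k"
    by (auto simp: homeomorphic_map_maps)
  \<comment> \<open>The theorem asks for a map towards the quotient, hence the inverse. The
    algebraic inverse and the topological inverse \<open>k\<close> must be identified; they agree on
    the space \<open>?E\<close>.\<close>
  have "inv_into (carrier (SpSp Mod Z2)) ?\<psi> \<in> iso E6_Int (SpSp Mod Z2)"
    using group.iso_set_sym[OF _ phi_factor_iso] normal.factorgroup_is_group[OF normal_kernel] by (simp add: phi_kernel)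
  moreover have "homeomorphic_map ?E ?Q (inv_into (carrier (SpSp Mod Z2)) ?\<psi>)"
  proof (rule homeomorphic_map_eq)
    show "homeomorphic_map ?E ?Q k"
      using k by (meson homeomorphic_map_maps homeomorphic_maps_sym)
    show "k X = inv_into (carrier (SpSp Mod Z2)) ?\<psi> X" if "X \<in> topspace ?E" for X
    proof (rule inv_into_f_eq[symmetric, OF inj])
      show "k X \<in> carrier (SpSp Mod Z2)" "?\<psi> (k X) = X"
        using k that unfolding homeomorphic_maps_def continuous_map_def Q by blast+
    qed
  qed
  ultimately show ?thesis
    unfolding topological_group_isomorphic_def by blast
qed

end
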